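(* Let $w\in\mathbb{R}^d$, let $m\ge1$, and for $j\in\{1,\dots,m\}$ let $B^{(j-1)}\in\mathbb{R}^{d\times d}$ be the SR1 Hessian approximation built from the preceding curvature pairs. Let $\tilde\lambda^{j-1}=(\tilde\lambda_1^{j-1},\dots,\tilde\lambda_d^{j-1})$ be the eigenvalues of the matrix $\nabla^2F(w)-B^{(j-1)}$, let $s_j\in\mathbb{R}^d$ be a random vector uniformly distributed on the unit sphere, and let $\epsilon>0$ be a prescribed tolerance. Then, for all $j\in\{1,\dots,m\}$, $$\mathbb{P}\left[\frac{|s_j^T(\nabla^2F(w)-B^{(j-1)})s_j|}{\|s_j\|^2}>\epsilon\right]=1+\frac1\pi\int_0^\infty\frac{\sin\left(\frac12\sum_{l=1}^d\tan^{-1}\big((\tilde\lambda_l^{j-1}-\epsilon)u\big)\right)}{u\prod_{l=1}^d\left(1+(\tilde\lambda_l^{j-1}-\epsilon)^2u^2\right)^{1/4}}\,du-\frac1\pi\int_0^\infty\frac{\sin\left(\frac12\sum_{l=1}^d\tan^{-1}\big((\tilde\lambda_l^{j-1}+\epsilon)u\big)\right)}{u\prod_{l=1}^d\left(1+(\tilde\lambda_l^{j-1}+\epsilon)^2u^2\right)^{1/4}}\,du.$$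
   Context: $F:\mathbb{R}^d\to\mathbb{R}$ is twice continuously differentiable. Curvature pairs have the form $(s_i,y_i)$ with $y_i=\nabla^2F(w)s_i$. $B^{(0)}$ is a symmetric initial matrix (a multiple of the identity, possibly $0$), and $B^{(j-1)}$ is the symmetric matrix obtained from $B^{(0)}$ by applying successively, for the accepted pairs $(s_i,y_i)$ with $i<j$, the SR1 update $B\mapsto B+\frac{(y_i-Bs_i)(y_i-Bs_i)^T}{(y_i-Bs_i)^Ts_i}$, where a pair is accepted if $|s_i^T(y_i-Bs_i)|>\epsilon\|s_i\|^2$ with $B$ the current matrix. The probability is over the random vector $s_j$, with $w$ and $B^{(j-1)}$ given.
   Formalization: The formula is proved for each j whose eigenvalues are not all equal to ε and not all equal to −ε; if ∇²F(w)−B^(j−1) is εI or −εI, the printed formula is false (probability 0, right side 1/2). *)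

theory Defs
  imports "HOL-Probability.Probability"
begin

definition gradient :: "(real^'n \<Rightarrow> real) \<Rightarrow> real^'n \<Rightarrow> real^'n" where
  "gradient F x = (\<chi> i. frechet_derivative F (at x) (axis i 1))"

definition hessian :: "(real^'n \<Rightarrow> real) \<Rightarrow> real^'n \<Rightarrow> real^'n^'n" where
  "hessian F x = jacobian (gradient F) (at x)"

(* frechet_derivative is an arbitrary choice where no derivative exists, so gradient and hessian
   are meaningful only under the two differentiability conjuncts. *)
definition twice_continuously_differentiable :: "(real^'n \<Rightarrow> real) \<Rightarrow> bool" where
  "twice_continuously_differentiable F \<longleftrightarrow>
     (\<forall>x. F differentiable (at x)) \<and>
     (\<forall>x. gradient F differentiable (at x)) \<and>
     continuous_on UNIV (hessian F)"

definition sr1_update :: "real^'n^'n \<Rightarrow> real^'n \<Rightarrow> real^'n \<Rightarrow> real^'n^'n" where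
  "sr1_update B s y =
     (let r = y - B *v s in B + (1 / (r \<bullet> s)) *\<^sub>R (\<chi> i j. r $ i * r $ j))"

definition sr1_accepts :: "real \<Rightarrow> real^'n^'n \<Rightarrow> real^'n \<Rightarrow> real^'n \<Rightarrow> bool" where
  "sr1_accepts \<epsilon> B s y \<longleftrightarrow> \<bar>s \<bullet> (y - B *v s)\<bar> > \<epsilon> * (norm s)\<^sup>2"

(* The k-th matrix is built from the pairs with indices 1, ..., k. *)
primrec sr1_matrix ::
  "real \<Rightarrow> real^'n^'n \<Rightarrow> (nat \<Rightarrow> real^'n) \<Rightarrow> (nat \<Rightarrow> real^'n) \<Rightarrow> nat \<Rightarrow> real^'n^'n" where
  "sr1_matrix \<epsilon> B0 s y 0 = B0"
| "sr1_matrix \<epsilon> B0 s y (Suc k) =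
     (if sr1_accepts \<epsilon> (sr1_matrix \<epsilon> B0 s y k) (s (Suc k)) (y (Suc k))
      then sr1_update (sr1_matrix \<epsilon> B0 s y k) (s (Suc k)) (y (Suc k))
      else sr1_matrix \<epsilon> B0 s y k)"

(* The family \<mu> lists the roots of the characteristic polynomial of A, repeated according to
   multiplicity.  The index type only serves to have exactly CARD('n) entries. *)
definition eigenvalue_family :: "real^'n^'n \<Rightarrow> ('n \<Rightarrow> real) \<Rightarrow> bool" where
  "eigenvalue_family A \<mu> \<longleftrightarrow> (\<forall>x. det (mat x - A) = (\<Prod>l\<in>UNIV. x - \<mu> l))"

(* Normalised surface measure of the unit sphere, as in polar coordinates: the mass of E is the
   proportion of the unit ball lying in the cone {r x. 0 < r < 1, x \<in> E}.  Recall that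
   sgn x = x /\<^sub>R norm x; the value sgn 0 = 0 only matters on a null set. *)
definition unit_sphere_measure :: "(real^'n) measure" where
  "unit_sphere_measure = distr (uniform_measure lborel (ball 0 1)) borel sgn"

definition uniform_on_unit_sphere :: "'a measure \<Rightarrow> ('a \<Rightarrow> real^'n) \<Rightarrow> bool" where
  "uniform_on_unit_sphere M X \<longleftrightarrow>
     X \<in> borel_measurable M \<and> distr M borel X = unit_sphere_measure"

lemma borel_measurable_sgn_vec: "(sgn :: real^'n \<Rightarrow> real^'n) \<in> borel_measurable borel"
  unfolding sgn_div_norm by measurable

lemma prob_space_uniform_unit_ball:
  "prob_space (uniform_measure lborel (ball (0::real^'n) 1))"
proof (rule prob_space_uniform_measure)
  show "emeasure lborel (ball (0::real^'n) 1) \<noteq> 0"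
    using content_ball_pos[of 1 "0::real^'n"] by (auto simp: measure_def)
  show "emeasure lborel (ball (0::real^'n) 1) \<noteq> \<infinity>"
    using emeasure_lborel_ball_finite[of "0::real^'n" 1] by simp
qed

lemma prob_space_unit_sphere_measure: "prob_space (unit_sphere_measure :: (real^'n) measure)"
  unfolding unit_sphere_measure_def
  by (rule prob_space.prob_space_distr[OF prob_space_uniform_unit_ball])
     (use borel_measurable_sgn_vec in \<open>simp add: measurable_def\<close>)

lemma AE_unit_sphere_measure: "AE x in (unit_sphere_measure :: (real^'n) measure). norm x = 1"
proof -
  have "AE x in uniform_measure lborel (ball (0::real^'n) 1). norm (sgn x) = 1"
  proof (rule AE_uniform_measureI)
    show "AE x in lborel. x \<in> ball (0::real^'n) 1 \<longrightarrow> norm (sgn x) = 1"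
      using AE_lborel_singleton[of "0::real^'n"] by eventually_elim (auto simp: norm_sgn)
  qed simp
  moreover have "(sgn :: real^'n \<Rightarrow> real^'n) \<in> uniform_measure lborel (ball 0 1) \<rightarrow>\<^sub>M borel"
    using borel_measurable_sgn_vec by (simp add: measurable_def)
  ultimately show ?thesis
    unfolding unit_sphere_measure_def by (subst AE_distr_iff) auto
qed

(* Translation-invariant measures are proportional (Fubini), and T maps the unit ball to itself. *)
lemma emeasure_lborel_orthogonal_vimage:
  fixes T :: "real^'n \<Rightarrow> real^'n"
  assumes T: "orthogonal_transformation T" and A [measurable]: "A \<in> sets borel"
  shows "emeasure lborel (T -` A) = emeasure lborel A"
proof -
  have lin: "linear T" using T orthogonal_transformation_linear by auto
  have mT [measurable]: "T \<in> borel_measurable borel"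
    using lin by (intro borel_measurable_continuous_onI linear_continuous_on)
      (simp add: linear_conv_bounded_linear)
  have surj: "\<exists>c. T c = x" for x
    using orthogonal_transformation_surj[OF T] by (metis surjD)
  have shift: "emeasure lborel ((\<lambda>z. z + c) -` B) = emeasure lborel B" if "B \<in> sets borel"
    for B and c :: "real^'n"
  proof -
    have "emeasure lborel B = emeasure (distr lborel borel ((+) c)) B"
      by (simp add: lborel_distr_plus)
    also have "\<dots> = emeasure lborel ((\<lambda>z. z + c) -` B)"
      using that by (subst emeasure_distr) (auto simp: add.commute[of c] intro!: arg_cong2[of _ _ _ _ emeasure])
    finally show ?thesis by simp
  qed
  define b where "b = ball (0::real^'n) 1"
  have b [measurable]: "b \<in> sets borel" by (simp add: b_def)
  have fin: "emeasure lborel b \<noteq> 0" "emeasure lborel b \<noteq> \<infinity>"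
    using content_ball_pos[of 1 "0::real^'n"] emeasure_lborel_ball_finite[of "0::real^'n" 1]
    by (auto simp: measure_def b_def)
  have slice1: "emeasure lborel {z. x - T z \<in> b} = emeasure lborel b" for x
  proof -
    obtain c where c: "T c = x" using surj by blast
    have "norm (x - T z) = norm (z + - c)" for z
    proof -
      have "x - T z = T (c - z)" using lin c by (simp add: linear_diff)
      then show ?thesis using T by (simp add: orthogonal_transformation_norm norm_minus_commute)
    qed
    then have "{z. x - T z \<in> b} = (\<lambda>z. z + - c) -` b" by (auto simp: b_def)
    then show ?thesis using shift[OF b, of "- c"] by (simp only:)
  qed
  have slice2: "emeasure lborel {z. x + T z \<in> A} = emeasure lborel (T -` A)" for x
  proof -
    obtain c where c: "T c = x" using surj by blast
    have "{z. x + T z \<in> A} = (\<lambda>z. z + c) -` (T -` A)"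
      using lin c by (auto simp: linear_add add.commute)
    then show ?thesis using shift[of "T -` A" c] measurable_sets[OF mT A] by simp
  qed
  have slice3: "(\<integral>\<^sup>+x. indicator A x * indicator b (x - T z) \<partial>lborel) =
      (\<integral>\<^sup>+x. indicator A (x + T z) * indicator b x \<partial>lborel)" for z
  proof -
    have "(\<integral>\<^sup>+x. indicator A x * indicator b (x - T z) \<partial>lborel) =
      (\<integral>\<^sup>+x. indicator A x * indicator b (x - T z) \<partial>distr lborel borel ((+) (T z)))"
      by (simp add: lborel_distr_plus)
    also have "\<dots> = (\<integral>\<^sup>+x. indicator A (x + T z) * indicator b x \<partial>lborel)"
      by (subst nn_integral_distr) (auto simp: add.commute)
    finally show ?thesis .
  qed
  have "emeasure lborel A * emeasure lborel b =
      (\<integral>\<^sup>+x. indicator A x * emeasure lborel {z. x - T z \<in> b} \<partial>lborel)"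
    by (simp add: slice1 nn_integral_multc)
  also have "\<dots> = (\<integral>\<^sup>+x. (\<integral>\<^sup>+z. indicator A x * indicator b (x - T z) \<partial>lborel) \<partial>lborel)"
  proof (rule nn_integral_cong)
    fix x
    have "(\<integral>\<^sup>+z. indicator b (x - T z) \<partial>lborel) =
        (\<integral>\<^sup>+z. indicator {z. x - T z \<in> b} z \<partial>lborel)"
      by (rule nn_integral_cong) (simp add: indicator_def)
    also have "\<dots> = emeasure lborel {z. x - T z \<in> b}"
      by (rule nn_integral_indicator) measurable
    finally show "indicator A x * emeasure lborel {z. x - T z \<in> b} =
        (\<integral>\<^sup>+z. indicator A x * indicator b (x - T z) \<partial>lborel)"
      by (simp add: nn_integral_cmult)
  qed
  also have "\<dots> = (\<integral>\<^sup>+z. (\<integral>\<^sup>+x. indicator A x * indicator b (x - T z) \<partial>lborel) \<partial>lborel)"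
    by (rule lborel_pair.Fubini') measurable
  also have "\<dots> = (\<integral>\<^sup>+z. (\<integral>\<^sup>+x. indicator A (x + T z) * indicator b x \<partial>lborel) \<partial>lborel)"
    by (simp add: slice3)
  also have "\<dots> = (\<integral>\<^sup>+x. (\<integral>\<^sup>+z. indicator A (x + T z) * indicator b x \<partial>lborel) \<partial>lborel)"
    by (rule lborel_pair.Fubini') measurable
  also have "\<dots> = (\<integral>\<^sup>+x. emeasure lborel {z. x + T z \<in> A} * indicator b x \<partial>lborel)"
  proof (rule nn_integral_cong)
    fix x
    have "(\<integral>\<^sup>+z. indicator A (x + T z) \<partial>lborel) =
        (\<integral>\<^sup>+z. indicator {z. x + T z \<in> A} z \<partial>lborel)"
      by (rule nn_integral_cong) (simp add: indicator_def)
    also have "\<dots> = emeasure lborel {z. x + T z \<in> A}"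
      by (rule nn_integral_indicator) measurable
    finally show "(\<integral>\<^sup>+z. indicator A (x + T z) * indicator b x \<partial>lborel) =
        emeasure lborel {z. x + T z \<in> A} * indicator b x"
      by (simp add: nn_integral_multc)
  qed
  also have "\<dots> = emeasure lborel (T -` A) * emeasure lborel b"
    by (simp add: slice2 nn_integral_cmult)
  finally show ?thesis using fin by (auto simp: ennreal_mult_cancel_left mult.commute[of _ "emeasure lborel b"])
qed

lemma unit_sphere_measure_rotation_invariant:
  fixes T :: "real^'n \<Rightarrow> real^'n"
  assumes T: "orthogonal_transformation T"
  shows "distr unit_sphere_measure borel T = unit_sphere_measure"
proof -
  let ?U = "uniform_measure lborel (ball (0::real^'n) 1)"
  have lin: "linear T" using T orthogonal_transformation_linear by auto
  have mT [measurable]: "T \<in> borel_measurable borel"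
    using lin by (intro borel_measurable_continuous_onI linear_continuous_on)
      (simp add: linear_conv_bounded_linear)
  have msgn: "(sgn :: real^'n \<Rightarrow> real^'n) \<in> ?U \<rightarrow>\<^sub>M borel"
    using borel_measurable_sgn_vec by (simp add: measurable_def)
  have mTU: "T \<in> ?U \<rightarrow>\<^sub>M ?U"
    using mT by (simp add: measurable_def)
  have ball: "T -` ball 0 1 = ball 0 1"
    using T by (auto simp: orthogonal_transformation_norm)
  have inv_U: "distr ?U ?U T = ?U"
  proof (rule measure_eqI)
    fix A assume "A \<in> sets (distr ?U ?U T)"
    then have A: "A \<in> sets borel" by simp
    have m: "T -` A \<in> sets borel" using measurable_sets[OF mT A] by simp
    have "ball 0 1 \<inter> T -` A = T -` (ball 0 1 \<inter> A)" using ball by auto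
    then have "emeasure ?U (T -` A) = emeasure ?U A"
      using A m emeasure_lborel_orthogonal_vimage[OF T, of "ball 0 1 \<inter> A"] by (simp add: emeasure_uniform_measure)
    then show "emeasure (distr ?U ?U T) A = emeasure ?U A"
      using A mTU by (simp add: emeasure_distr)
  qed simp
  have comm: "T \<circ> sgn = sgn \<circ> T"
    using T lin by (auto simp: sgn_div_norm linear_cmul orthogonal_transformation_norm)
  have "distr unit_sphere_measure borel T = distr ?U borel (T \<circ> sgn)"
    unfolding unit_sphere_measure_def by (rule distr_distr[OF mT msgn])
  also have "\<dots> = distr (distr ?U ?U T) borel sgn"
    unfolding comm by (rule distr_distr[OF msgn mTU, symmetric])
  finally show ?thesis by (simp add: inv_U unit_sphere_measure_def)
qed

end

theory Submission
  imports Defs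
begin

text \<open>
  Let \<open>A\<close> be the Hessian minus the SR1 matrix. It is symmetric, and on the unit sphere the event splits into
  the disjoint events \<open>x \<bullet> (A - \<epsilon>) x > 0\<close> and \<open>x \<bullet> (A + \<epsilon>) x < 0\<close>. These are cones, so the uniform
  distribution on the sphere may be replaced by a standard Gaussian, for which, by rotation invariance,
  the quadratic form becomes a weighted sum of squares of independent standard normal variables.
  Half of such a sum has the characteristic function with modulus \<open>\<Prod>l. (1 + \<mu>\<^sub>l\<^sup>2 u\<^sup>2) powr (- 1 / 4)\<close>
  and argument \<open>1 / 2 * (\<Sum>l. arctan (\<mu>\<^sub>l u))\<close>; for a single square this follows from a linear differential
  equation obtained by integration by parts. The Gil-Pelaez formula
  \<open>E (sgn X) = 2 / pi * \<integral>u. E (sin (u X)) / u\<close>, a consequence of Dirichlet's integral, then gives both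
  probabilities (Imhof's formula).
\<close>

section \<open>Symmetry of the Hessian and of the SR1 matrices\<close>

text \<open>The mean value theorem along \<open>u\<close> turns the second difference into
  \<open>t\<close> times an increment of \<open>G\<close>, taken between two points within distance
  \<open>t * K\<close> of \<open>w\<close>; differentiability of \<open>G\<close> at
  \<open>w\<close> evaluates that increment. The quotient is symmetric in \<open>u\<close> and
  \<open>v\<close>, whereas the form of the limit is not; this is the source of the symmetry of
  second derivatives.\<close>

lemma second_difference_tendsto:
  fixes F :: "'a::real_inner \<Rightarrow> real"
  assumes F: "\<And>x. (F has_derivative (\<lambda>h. G x \<bullet> h)) (at x)"
    and G: "(G has_derivative G') (at w)"
  shows "((\<lambda>t. (F (w + t *\<^sub>R u + t *\<^sub>R v) - F (w + t *\<^sub>R u) - F (w + t *\<^sub>R v) + F w) / t\<^sup>2)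
    \<longlongrightarrow> G' v \<bullet> u) (at_right 0)"
proof (rule tendstoI)
  fix e :: real assume e: "e > 0"
  define K where "K = 1 + norm u + norm v"
  have K: "K > 0" "norm u \<le> K" "norm v \<le> K" by (auto simp: K_def add_pos_nonneg)
  interpret G': bounded_linear G' using G by (rule has_derivative_bounded_linear)
  \<comment> \<open>Two remainders, each at most \<open>e' * (t * K)\<close>, are paired with
    \<open>u\<close> of norm at most \<open>K\<close>; this choice makes the total error
    \<open>t * (e / 2)\<close>.\<close>
  define e' where "e' = e / (4 * K\<^sup>2)"
  have e': "e' > 0" using e K by (simp add: e'_def)
  obtain d where d: "d > 0"
    "\<And>y. norm (y - w) < d \<Longrightarrow> norm (G y - G w - G' (y - w)) \<le> e' * norm (y - w)"
    using G e' unfolding has_derivative_at_alt by metis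
  have "dist ((F (w + t *\<^sub>R u + t *\<^sub>R v) - F (w + t *\<^sub>R u) - F (w + t *\<^sub>R v) + F w) / t\<^sup>2)
          (G' v \<bullet> u) < e" if t: "t > 0" "t < d / K" for t
  proof -
    define \<phi> where "\<phi> r = F (w + r *\<^sub>R u + t *\<^sub>R v) - F (w + r *\<^sub>R u)" for r
    have der: "(\<phi> has_derivative (\<lambda>h. h * ((G (w + r *\<^sub>R u + t *\<^sub>R v) - G (w + r *\<^sub>R u)) \<bullet> u)))
        (at r within X)" for r X
    proof -
      have 1: "((\<lambda>r. w + r *\<^sub>R u + c) has_derivative (\<lambda>h. h *\<^sub>R u)) (at r within X)" for c
        by (auto intro!: derivative_eq_intros)
      have "((\<lambda>r. F (w + r *\<^sub>R u + c)) has_derivative (\<lambda>h. G (w + r *\<^sub>R u + c) \<bullet> h *\<^sub>R u))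
          (at r within X)" for c
        using has_derivative_compose[OF 1 F] .
      from has_derivative_diff[OF this[of "t *\<^sub>R v"] this[of 0]] show ?thesis
        by (simp add: \<phi>_def[abs_def] inner_diff_left algebra_simps)
    qed
    obtain r where r: "0 < r" "r < t"
      and \<phi>: "\<phi> t - \<phi> 0 = (t - 0) * ((G (w + r *\<^sub>R u + t *\<^sub>R v) - G (w + r *\<^sub>R u)) \<bullet> u)"
      using mvt_simple[OF t(1) der] by auto
    have bound: "norm (G (w + h) - G w - G' h) \<le> e' * (t * K)" if "norm h \<le> t * K" for h
    proof -
      have "norm h < d" using that t K by (simp add: field_simps)
      then have "norm (G (w + h) - G w - G' h) \<le> e' * norm h" using d(2)[of "w + h"] by simp
      also have "\<dots> \<le> e' * (t * K)" using that e' by (intro mult_left_mono) auto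
      finally show ?thesis .
    qed
    have h1: "norm (r *\<^sub>R u) \<le> t * norm u" using r by (auto intro: mult_right_mono)
    have h2: "norm (r *\<^sub>R u + t *\<^sub>R v) \<le> t * norm u + t * norm v"
      using norm_triangle_ineq[of "r *\<^sub>R u" "t *\<^sub>R v"] h1 t by simp
    have t0: "0 \<le> t * norm v" "t * K = t + t * norm u + t * norm v"
      using t by (auto simp: K_def algebra_simps)
    define R1 where "R1 = G (w + (r *\<^sub>R u + t *\<^sub>R v)) - G w - G' (r *\<^sub>R u + t *\<^sub>R v)"
    define R2 where "R2 = G (w + r *\<^sub>R u) - G w - G' (r *\<^sub>R u)"
    have R1: "norm R1 \<le> e' * (t * K)"
      unfolding R1_def by (rule bound) (use h2 t0 t in linarith)
    have R2: "norm R2 \<le> e' * (t * K)"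
      unfolding R2_def by (rule bound) (use h1 t0 t in linarith)
    \<comment> \<open>The contributions of \<open>r *\<^sub>R u\<close> to the two linearisations
      cancel, so the unknown intermediate point \<open>r\<close> survives only in the
      remainders.\<close>
    have eq: "G (w + r *\<^sub>R u + t *\<^sub>R v) - G (w + r *\<^sub>R u) = t *\<^sub>R G' v + (R1 - R2)"
      by (simp add: R1_def R2_def G'.add G'.scaleR algebra_simps)
    have "\<bar>(R1 - R2) \<bullet> u\<bar> \<le> norm (R1 - R2) * norm u" by (rule Cauchy_Schwarz_ineq2)
    also have "\<dots> \<le> (2 * (e' * (t * K))) * K"
      using R1 R2 norm_triangle_ineq4[of R1 R2] K e' t by (intro mult_mono) auto
    also have "\<dots> = t * (e / 2)" using K by (simp add: e'_def field_simps power2_eq_square)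
    finally have small: "\<bar>(R1 - R2) \<bullet> u\<bar> \<le> t * (e / 2)" .
    have "(F (w + t *\<^sub>R u + t *\<^sub>R v) - F (w + t *\<^sub>R u) - F (w + t *\<^sub>R v) + F w) = \<phi> t - \<phi> 0"
      by (simp add: \<phi>_def)
    also have "\<dots> / t\<^sup>2 - G' v \<bullet> u = (R1 - R2) \<bullet> u / t"
      unfolding \<phi> eq using t by (simp add: inner_add_left inner_diff_left field_simps power2_eq_square)
    finally have "dist ((F (w + t *\<^sub>R u + t *\<^sub>R v) - F (w + t *\<^sub>R u) - F (w + t *\<^sub>R v) + F w) / t\<^sup>2)
          (G' v \<bullet> u) = \<bar>(R1 - R2) \<bullet> u\<bar> / t"
      using t by (simp add: dist_real_def abs_divide)
    also have "\<dots> \<le> e / 2" using small t by (simp add: field_simps)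
    finally show ?thesis using e by simp
  qed
  then show "\<forall>\<^sub>F t in at_right 0. dist ((F (w + t *\<^sub>R u + t *\<^sub>R v) - F (w + t *\<^sub>R u) -
      F (w + t *\<^sub>R v) + F w) / t\<^sup>2) (G' v \<bullet> u) < e"
    using d(1) K by (intro eventually_at_rightI[of 0 "d / K"]) auto
qed

text \<open>Exchanging \<open>u\<close> and \<open>v\<close> does not change the second difference,
  so its two limits coincide.\<close>

lemma derivative_of_gradient_symmetric:
  fixes F :: "'a::real_inner \<Rightarrow> real"
  assumes F: "\<And>x. (F has_derivative (\<lambda>h. G x \<bullet> h)) (at x)"
    and G: "(G has_derivative G') (at w)"
  shows "G' u \<bullet> v = G' v \<bullet> u"
proof -
  have eq: "w + t *\<^sub>R v + t *\<^sub>R u = w + t *\<^sub>R u + t *\<^sub>R v" for t by simp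
  have "((\<lambda>t. (F (w + t *\<^sub>R u + t *\<^sub>R v) - F (w + t *\<^sub>R u) - F (w + t *\<^sub>R v) + F w) / t\<^sup>2)
      \<longlongrightarrow> G' u \<bullet> v) (at_right 0)"
    using second_difference_tendsto[OF F G, of v u] unfolding eq by (simp add: algebra_simps)
  from tendsto_unique[OF _ this second_difference_tendsto[OF F G]] show ?thesis by simp
qed

lemma transpose_hessian:
  fixes F :: "real^'n \<Rightarrow> real"
  assumes "twice_continuously_differentiable F"
  shows "transpose (hessian F w) = hessian F w"
proof -
  \<comment> \<open>Differentiability makes the chosen \<open>frechet_derivative\<close> a genuine
    derivative, and linearity identifies it with pairing against the gradient.\<close>
  have F: "(F has_derivative (\<lambda>h. gradient F x \<bullet> h)) (at x)" for x
  proof -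
    have der: "(F has_derivative frechet_derivative F (at x)) (at x)"
      using assms by (simp add: twice_continuously_differentiable_def frechet_derivative_works)
    interpret D: linear "frechet_derivative F (at x)"
      using der by (rule has_derivative_linear)
    have "frechet_derivative F (at x) h = gradient F x \<bullet> h" for h
    proof -
      have "frechet_derivative F (at x) (\<Sum>i\<in>UNIV. h $ i *s axis i 1) = gradient F x \<bullet> h"
        by (simp add: D.sum D.scaleR inner_vec_def gradient_def scalar_mult_eq_scaleR mult.commute)
      then show ?thesis by (simp add: basis_expansion)
    qed
    then have "frechet_derivative F (at x) = (\<lambda>h. gradient F x \<bullet> h)" by auto
    then show ?thesis using der by simp
  qed
  have G: "(gradient F has_derivative (\<lambda>h. hessian F w *v h)) (at w)"
    using assms unfolding twice_continuously_differentiable_def hessian_def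
    by (simp add: jacobian_works)
  have "hessian F w $ i $ j = hessian F w $ j $ i" for i j
    using derivative_of_gradient_symmetric[OF F G, of "axis j 1" "axis i 1"]
    by (simp add: matrix_vector_mul_component inner_axis row_def axis_def
        matrix_vector_mult_basis column_def inner_vec_def if_distrib cong: if_cong)
  then show ?thesis by (simp add: transpose_def vec_eq_iff)
qed

text \<open>The correction added to \<open>B\<close> is a scalar multiple of the symmetric matrix
  \<open>r r^T\<close>.\<close>

lemma transpose_sr1_update:
  assumes "transpose B = B"
  shows "transpose (sr1_update B s y) = sr1_update B s y"
proof -
  have "B $ j $ i = B $ i $ j" for i j
    using arg_cong[OF assms, of "\<lambda>M. M $ i $ j"] by (simp add: transpose_def)
  then show ?thesis
    by (auto simp: sr1_update_def Let_def transpose_def vec_eq_iff mult.commute)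
qed

lemma transpose_sr1_matrix:
  assumes "transpose B0 = B0"
  shows "transpose (sr1_matrix \<epsilon> B0 s y k) = sr1_matrix \<epsilon> B0 s y k"
  by (induction k) (simp_all add: assms transpose_sr1_update)

section \<open>Spectral theorem for real symmetric matrices\<close>

text \<open>The eigenvector maximises the quadratic form on the unit sphere of the subspace.\<close>

lemma self_adjoint_eigenvector:
  fixes f :: "'a::euclidean_space \<Rightarrow> 'a"
  assumes f: "linear f" and sym: "\<And>x y. f x \<bullet> y = x \<bullet> f y"
    and S: "subspace S" "f ` S \<subseteq> S" "S \<noteq> {0}"
  obtains v c where "v \<in> S" "norm v = 1" "f v = c *\<^sub>R v"
proof -
  interpret f: linear f by fact
  have cont: "continuous_on X (\<lambda>x. x \<bullet> f x)" for X
    using linear_continuous_on[of f X] f by (auto intro!: continuous_intros simp: linear_conv_bounded_linear)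
  obtain z where z: "z \<in> S" "z \<noteq> 0" using S subspace_0 by blast
  then have "sgn z \<in> sphere 0 1 \<inter> S"
    using S by (auto simp: norm_sgn sgn_div_norm intro: subspace_mul)
  then have "sphere 0 1 \<inter> S \<noteq> {}" by blast
  moreover have "compact (sphere 0 1 \<inter> S)"
    using S by (intro compact_Int_closed closed_subspace) auto
  ultimately obtain v where "v \<in> sphere 0 1 \<inter> S"
    and "\<forall>x\<in>sphere 0 1 \<inter> S. x \<bullet> f x \<le> v \<bullet> f v"
    using continuous_attains_sup[OF _ _ cont, of "sphere 0 1 \<inter> S"] by blast
  then have v: "v \<in> S" "norm v = 1"
    and max: "\<And>x. x \<in> S \<Longrightarrow> norm x = 1 \<Longrightarrow> x \<bullet> f x \<le> v \<bullet> f v"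
    by auto
  define c where "c = v \<bullet> f v"
  have le: "x \<bullet> f x \<le> c * (x \<bullet> x)" if "x \<in> S" for x
  proof (cases "x = 0")
    case False
    have "sgn x \<bullet> f (sgn x) \<le> c"
      unfolding c_def using S that False
      by (intro max) (auto simp: norm_sgn sgn_div_norm intro: subspace_mul)
    then have "x \<bullet> f x / (norm x)\<^sup>2 \<le> c"
      by (simp add: sgn_div_norm f.scaleR power2_eq_square divide_inverse ac_simps)
    then show ?thesis
      using False by (simp add: dot_square_norm divide_le_eq)
  qed (simp add: f.zero)
  \<comment> \<open>First-order condition: along \<open>v + t *\<^sub>R y\<close> the form
    \<open>x \<bullet> f x - c * (x \<bullet> x)\<close> is nonpositive and vanishes at
    \<open>t = 0\<close>, so its linear term in \<open>t\<close> must vanish.\<close>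
  have orth: "f v \<bullet> y = 0" if y: "y \<in> S" "v \<bullet> y = 0" for y
  proof -
    define D where "D = c * (y \<bullet> y) - y \<bullet> f y"
    have D: "D \<ge> 0" using le[OF y(1)] by (simp add: D_def)
    have vv: "v \<bullet> v = 1" using v by (simp add: dot_square_norm)
    have ineq: "2 * t * (f v \<bullet> y) \<le> t\<^sup>2 * D" for t
    proof -
      have "v + t *\<^sub>R y \<in> S" using S v y by (auto intro: subspace_add subspace_mul)
      from le[OF this] show ?thesis
        using y(2) vv sym[of v y]
        by (simp add: D_def f.add f.scaleR inner_add_left inner_add_right c_def algebra_simps
            power2_eq_square inner_commute)
    qed
    define a where "a = f v \<bullet> y"
    \<comment> \<open>A value of \<open>t\<close> at which a nonzero linear term would beat the
      quadratic one; \<open>D + 1\<close> replaces \<open>D\<close> because \<open>D\<close> may be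
      zero.\<close>
    define k where "k = a / (D + 1)"
    have k: "a = k * (D + 1)" using D by (simp add: k_def)
    have "2 * k * a \<le> k\<^sup>2 * D" using ineq[of k] by (simp add: a_def)
    also have "\<dots> \<le> k\<^sup>2 * (D + 1)" by (intro mult_left_mono) auto
    also have "\<dots> = k * a" using k by algebra
    finally have "k * a \<le> 0" by (simp add: mult.commute)
    then have "(k * a) * (D + 1) \<le> 0" using D mult_nonpos_nonneg[of "k * a" "D + 1"] by simp
    then have "a * a \<le> 0" using k by (simp add: ac_simps)
    then show ?thesis by (auto simp: a_def mult_le_0_iff)
  qed
  \<comment> \<open>The defect \<open>r\<close> lies in \<open>S\<close> and is orthogonal to
    \<open>v\<close>, hence by the first-order condition to \<open>f v\<close>, hence to
    itself.\<close>
  define r where "r = f v - c *\<^sub>R v"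
  have "r \<in> S" using S v unfolding r_def by (intro subspace_diff subspace_mul) auto
  moreover have vr: "v \<bullet> r = 0"
    using v by (simp add: r_def inner_diff_right c_def dot_square_norm)
  ultimately have "f v \<bullet> r = 0" by (rule orth)
  then have "r \<bullet> r = 0" using vr by (simp add: r_def inner_diff_left)
  then have "f v = c *\<^sub>R v" by (simp add: r_def)
  with v that show ?thesis by blast
qed

text \<open>Induction on the dimension: split off one eigenvector \<open>v\<close>. Self-adjointness
  makes its orthogonal complement within \<open>S\<close> invariant under \<open>f\<close>, and that
  complement has dimension one less.\<close>

lemma self_adjoint_eigenbasis:
  fixes f :: "'a::euclidean_space \<Rightarrow> 'a"
  assumes f: "linear f" and sym: "\<And>x y. f x \<bullet> y = x \<bullet> f y"
    and "subspace S" "f ` S \<subseteq> S"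
  shows "\<exists>B. B \<subseteq> S \<and> finite B \<and> card B = dim S \<and> pairwise orthogonal B \<and>
    (\<forall>b\<in>B. norm b = 1 \<and> (\<exists>c. f b = c *\<^sub>R b))"
  using assms(3,4)
proof (induction "dim S" arbitrary: S)
  case 0
  then show ?case by (intro exI[of _ "{}"]) auto
next
  case (Suc n)
  then have "S \<noteq> {0}" by auto
  then obtain v c where v: "v \<in> S" "norm v = 1" "f v = c *\<^sub>R v"
    using self_adjoint_eigenvector[OF f sym Suc.prems] by metis
  define S' where "S' = {y \<in> S. \<forall>x\<in>span {v}. orthogonal x y}"
  have S': "y \<in> S' \<longleftrightarrow> y \<in> S \<and> v \<bullet> y = 0" for y
    by (auto simp: S'_def orthogonal_def span_singleton)
  have "span {v} \<subseteq> S" using v Suc.prems by (simp add: span_minimal)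
  then have "dim S' + dim (span {v}) = dim S"
    unfolding S'_def using Suc.prems by (intro dim_subspace_orthogonal_to_vectors) auto
  moreover have "v \<noteq> 0" using v by auto
  ultimately have dim: "n = dim S'" using Suc.hyps by simp
  have "subspace S'"
    using Suc.prems by (auto simp: subspace_def S' inner_add_right)
  moreover have "f ` S' \<subseteq> S'"
    using v subsetD[OF Suc.prems(2)] by (auto simp: S' sym[symmetric])
  ultimately obtain B where B: "B \<subseteq> S'" "finite B" "card B = dim S'" "pairwise orthogonal B"
    "\<And>b. b \<in> B \<Longrightarrow> norm b = 1 \<and> (\<exists>c. f b = c *\<^sub>R b)"
    using Suc.hyps(1)[OF dim] by blast
  have "v \<notin> B" using B v S' by (auto simp: dot_square_norm)
  then show ?case
    using B v S' dim Suc.hyps(2)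
    by (intro exI[of _ "insert v B"])
       (auto simp: pairwise_insert orthogonal_def inner_commute)
qed

lemma symmetric_matrix_diagonalisable:
  fixes A :: "real^'n^'n"
  assumes A: "transpose A = A"
  obtains P \<mu> where "orthogonal_matrix P" "\<And>l. A *v column l P = \<mu> l *\<^sub>R column l P"
proof -
  have sym: "(A *v x) \<bullet> y = x \<bullet> (A *v y)" for x y
    using dot_lmul_matrix[of x "transpose A" y] unfolding vector_transpose_matrix by (simp add: A)
  obtain B where B: "card B = dim (UNIV :: (real^'n) set)" "finite B" "pairwise orthogonal B"
    "\<And>b. b \<in> B \<Longrightarrow> norm b = 1 \<and> (\<exists>c. A *v b = c *\<^sub>R b)"
    using self_adjoint_eigenbasis[of "\<lambda>x. A *v x" UNIV] sym by auto
  have "card (UNIV :: 'n set) = card B" using B(1) by simp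
  then obtain h where h: "bij_betw h (UNIV :: 'n set) B"
    using B(2) finite_same_card_bij[of "UNIV :: 'n set" B] by auto
  define P where "P = (\<chi> i j. h j $ i)"
  have col: "column l P = h l" for l by (simp add: P_def column_def)
  have hB: "h l \<in> B" for l using h by (auto simp: bij_betw_def)
  have inj: "h i \<noteq> h j" if "i \<noteq> j" for i j using h that by (auto simp: bij_betw_def inj_def)
  have "orthogonal_matrix P"
    using B hB inj by (auto simp: orthogonal_matrix_orthonormal_columns col pairwise_def)
  moreover have "\<forall>l. \<exists>c. A *v h l = c *\<^sub>R h l" using B(4) hB by blast
  then have "\<exists>\<mu>. \<forall>l. A *v column l P = \<mu> l *\<^sub>R column l P"
    unfolding col by (rule choice)
  ultimately show ?thesis using that by blast
qed

text \<open>The eigenvector equations say \<open>(mat x - A) ** P = P ** D\<close> with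
  \<open>D\<close> diagonal; take determinants and cancel \<open>det P\<close>.\<close>

lemma det_mat_diff_of_eigenbasis:
  fixes A P :: "real^'n^'n"
  assumes P: "orthogonal_matrix P" and eig: "\<And>l. A *v column l P = \<mu> l *\<^sub>R column l P"
  shows "det (mat x - A) = (\<Prod>l\<in>UNIV. x - \<mu> l)"
proof -
  define D :: "real^'n^'n" where "D = (\<chi> i j. if i = j then x - \<mu> i else 0)"
  have "(mat x - A) ** P = P ** D"
  proof -
    have "((mat x - A) ** P) $ i $ j = (P ** D) $ i $ j" for i j
    proof -
      have "(A ** P) $ i $ j = (A *v column j P) $ i"
        by (simp add: matrix_matrix_mult_def matrix_vector_mult_def column_def)
      also have "\<dots> = \<mu> j * P $ i $ j" by (simp only: eig) (simp add: column_def)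
      finally have AP: "(A ** P) $ i $ j = \<mu> j * P $ i $ j" .
      have "((mat x - A) ** P) $ i $ j = (mat x ** P) $ i $ j - (A ** P) $ i $ j"
        by (simp add: matrix_matrix_mult_def left_diff_distrib sum_subtractf)
      also have "(mat x ** P) $ i $ j = x * P $ i $ j"
        by (simp add: matrix_matrix_mult_def mat_def if_distrib[of "\<lambda>z. z * _"] cong: if_cong)
      also have "x * P $ i $ j - (A ** P) $ i $ j = P $ i $ j * (x - \<mu> j)"
        by (simp only: AP) (simp add: algebra_simps)
      also have "\<dots> = (P ** D) $ i $ j"
        by (simp add: matrix_matrix_mult_def D_def if_distrib[of "\<lambda>z. _ * z"] cong: if_cong)
      finally show ?thesis .
    qed
    then show ?thesis by (simp add: vec_eq_iff)
  qed
  then have "det (mat x - A) * det P = det P * det D" by (metis det_mul)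
  moreover have "det P \<noteq> 0" using det_orthogonal_matrix[OF P] by auto
  ultimately have "det (mat x - A) = det D" by simp
  also have "\<dots> = (\<Prod>l\<in>UNIV. x - \<mu> l)" by (subst det_diagonal) (auto simp: D_def)
  finally show ?thesis .
qed

text \<open>Polynomials with equal values are equal and so have the same multiset of roots. This
  matches a prescribed eigenvalue family with the one produced by diagonalisation, up to
  order.\<close>

lemma image_mset_eq_of_prod_eq:
  fixes \<mu> \<nu> :: "'n::finite \<Rightarrow> real"
  assumes "\<And>x. (\<Prod>l\<in>UNIV. x - \<mu> l) = (\<Prod>l\<in>UNIV. x - \<nu> l)"
  shows "image_mset \<mu> (mset_set UNIV) = image_mset \<nu> (mset_set UNIV)"
proof -
  have p: "proots (\<Prod>l\<in>UNIV. [:- \<mu> l, 1:]) = image_mset \<mu> (mset_set UNIV)" for \<mu> :: "'n \<Rightarrow> real"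
    by (subst proots_prod) (auto simp: sum_unfold_sum_mset)
  have "poly (\<Prod>l\<in>UNIV. [:- \<mu> l, 1:]) = poly (\<Prod>l\<in>UNIV. [:- \<nu> l, 1:])"
    using assms by (auto simp: poly_prod fun_eq_iff)
  then show ?thesis by (metis p poly_eq_poly_eq_iff)
qed

section \<open>The characteristic function of a squared Gaussian\<close>

text \<open>Differentiation under the integral sign. The mean value inequality makes
  \<open>f t x\<close> Lipschitz in \<open>t\<close> with constant \<open>g x\<close>, so the
  normalised remainder is dominated by \<open>2 * g x\<close>.\<close>

lemma has_vector_derivative_integral_dominated:
  fixes f :: "real \<Rightarrow> 'a \<Rightarrow> 'b::{banach, second_countable_topology}"
  assumes int: "\<And>t. integrable M (f t)"
    and der: "\<And>t x. x \<in> space M \<Longrightarrow> ((\<lambda>t. f t x) has_vector_derivative f' t x) (at t)"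
    and f'[measurable]: "f' s \<in> borel_measurable M"
    and g: "integrable M g" "\<And>t x. x \<in> space M \<Longrightarrow> norm (f' t x) \<le> g x"
  shows "((\<lambda>t. \<integral>x. f t x \<partial>M) has_vector_derivative (\<integral>x. f' s x \<partial>M)) (at s)"
proof -
  have int': "integrable M (f' s)"
    using f' g(2) by (intro Bochner_Integration.integrable_bound[OF g(1)]) (auto intro!: AE_I2 order_trans[OF _ abs_ge_self])
  \<comment> \<open>The remainder quotient from the definition of the derivative: the claim is that
    its integral tends to 0. Dominated convergence is applied along sequences that avoid
    \<open>s\<close>, where the quotient would have denominator 0.\<close>
  define q where "q t x = (1 / norm (t - s)) *\<^sub>R (f t x - (f s x + (t - s) *\<^sub>R f' s x))" for t x
  have lip: "norm (f t x - f s x) \<le> g x * norm (t - s)" if "x \<in> space M" for t x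
  proof (rule differentiable_bound[where S=UNIV and f'="\<lambda>t h. h *\<^sub>R f' t x"])
    show "((\<lambda>t. f t x) has_derivative (\<lambda>h. h *\<^sub>R f' u x)) (at u within UNIV)" for u
      using der[OF that] by (simp add: has_vector_derivative_def)
    show "onorm (\<lambda>h. h *\<^sub>R f' u x) \<le> g x" for u
      using g(2)[OF that, of u] by (intro onorm_le) (auto simp: mult.commute intro: mult_left_mono)
  qed auto
  have lim: "((\<lambda>t. \<integral>x. q t x \<partial>M) \<longlongrightarrow> 0) (at s)"
    unfolding tendsto_at_iff_sequentially comp_def
  proof (intro allI impI)
    fix X :: "nat \<Rightarrow> real" assume X: "\<forall>i. X i \<in> UNIV - {s}" "X \<longlonglongrightarrow> s"
    have "(\<lambda>n. \<integral>x. q (X n) x \<partial>M) \<longlonglongrightarrow> (\<integral>x. 0 \<partial>M)"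
    proof (rule integral_dominated_convergence[where w="\<lambda>x. 2 * g x"])
      show "AE x in M. (\<lambda>n. q (X n) x) \<longlonglongrightarrow> 0"
      proof (rule AE_I2)
        fix x assume "x \<in> space M"
        from der[OF this, of s] have "((\<lambda>t. q t x) \<longlongrightarrow> 0) (at s)"
          by (simp add: has_vector_derivative_def has_derivative_within q_def)
        then show "(\<lambda>n. q (X n) x) \<longlonglongrightarrow> 0"
          using X unfolding tendsto_at_iff_sequentially comp_def by blast
      qed
      show "AE x in M. norm (q (X n) x) \<le> 2 * g x" for n
      proof (rule AE_I2)
        fix x assume x: "x \<in> space M"
        have "norm (f (X n) x - f s x - (X n - s) *\<^sub>R f' s x) \<le>
            g x * norm (X n - s) + norm (X n - s) * g x"
          using lip[OF x, of "X n"] g(2)[OF x, of s]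
          by (intro order_trans[OF norm_triangle_ineq4[of "f (X n) x - f s x"]] add_mono) (auto intro: mult_left_mono)
        also have "\<dots> = 2 * g x * norm (X n - s)" by simp
        finally show "norm (q (X n) x) \<le> 2 * g x"
          using X(1) by (simp add: q_def divide_le_eq diff_diff_eq)
      qed
      show "(\<lambda>x. q (X n) x) \<in> borel_measurable M" for n
        unfolding q_def using int[THEN borel_measurable_integrable] by measurable
    qed (use g in auto)
    then show "(\<lambda>n. \<integral>x. q (X n) x \<partial>M) \<longlonglongrightarrow> 0" by simp
  qed
  have "(\<integral>x. q t x \<partial>M) =
      (1 / norm (t - s)) *\<^sub>R ((\<integral>x. f t x \<partial>M) - ((\<integral>x. f s x \<partial>M) + (t - s) *\<^sub>R (\<integral>x. f' s x \<partial>M)))" for t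
    unfolding q_def using int int' by simp
  then show ?thesis
    using lim unfolding has_vector_derivative_def has_derivative_within
    by (auto intro: bounded_linear_scaleR_left)
qed

lemma has_vector_derivative_cis:
  assumes "(f has_real_derivative f') (at x within S)"
  shows "((\<lambda>x. cis (f x)) has_vector_derivative (\<i> * of_real f' * cis (f x))) (at x within S)"
proof -
  have "((\<lambda>z. exp (\<i> * z)) has_field_derivative \<i> * exp (\<i> * of_real (f x))) (at (of_real (f x)))"
    by (auto intro!: derivative_eq_intros)
  from vector_diff_chain_within[OF assms[unfolded has_real_derivative_iff_has_vector_derivative]
      has_vector_derivative_real_field[OF this]]
  show ?thesis by (simp add: o_def cis_conv_exp scaleR_conv_of_real mult_ac)
qed

lemma borel_measurable_cis [measurable]: "cis \<in> borel_measurable borel"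
  by (intro borel_measurable_continuous_onI) (auto simp: cis_conv_exp intro!: continuous_intros)


lemma integrable_std_normal_moment_cis:
  "integrable lborel (\<lambda>x. complex_of_real (std_normal_density x * x ^ k) * cis (s * x\<^sup>2 / 2))"
  by (rule Bochner_Integration.integrable_bound[OF integrable_std_normal_moment_abs[of k]])
    (auto simp: norm_mult norm_power)

text \<open>The function \<open>G x = x * std_normal_density x * c x\<close> vanishes at both ends,
  so its derivative has integral 0. Since the density has derivative
  \<open>- x * std_normal_density x\<close> and \<open>c\<close> has derivative
  \<open>\<i> * s * x * c x\<close>, this relates the second-moment integral to the plain
  one.\<close>

lemma std_normal_chi_square_by_parts:
  "(\<integral>x. complex_of_real (std_normal_density x) * cis (s * x\<^sup>2 / 2) \<partial>lborel) =
   (1 - \<i> * s) * (\<integral>x. complex_of_real (std_normal_density x * x\<^sup>2) * cis (s * x\<^sup>2 / 2) \<partial>lborel)"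
proof -
  define c where "c x = cis (s * x\<^sup>2 / 2)" for x
  define G where "G x = complex_of_real (x * std_normal_density x) * c x" for x
  define G' where "G' x = complex_of_real (std_normal_density x) * c x +
      (\<i> * s - 1) * (complex_of_real (std_normal_density x * x\<^sup>2) * c x)" for x
  have G: "(G has_vector_derivative G' x) (at x)" for x
  proof -
    have 1: "((\<lambda>x. complex_of_real (x * std_normal_density x)) has_vector_derivative
        complex_of_real (std_normal_density x - x\<^sup>2 * std_normal_density x)) (at x)"
      unfolding std_normal_density_def
      by (auto intro!: derivative_eq_intros has_vector_derivative_of_real
          simp: has_real_derivative_iff_has_vector_derivative[symmetric] field_simps power2_eq_square)
    have 2: "(c has_vector_derivative (\<i> * of_real (s * x) * c x)) (at x)"
      unfolding c_def by (rule has_vector_derivative_cis) (auto intro!: derivative_eq_intros)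
    show ?thesis
      using has_vector_derivative_mult[OF 1 2] unfolding G_def[abs_def] G'_def
      by (simp add: algebra_simps power2_eq_square)
  qed
  have intG': "integrable lborel G'"
    unfolding G'_def c_def
    using integrable_std_normal_moment_cis[of 0] integrable_std_normal_moment_cis[of 2] by simp
  \<comment> \<open>A crude bound that suffices for decay at infinity; it comes from
    \<open>1 + z \<le> exp z\<close> with \<open>z = x\<^sup>2 / 2\<close> and from
    \<open>2 \<le> sqrt (2 * pi)\<close>.\<close>
  have norm_G: "norm (G x) \<le> 1 / \<bar>x\<bar>" if "x \<noteq> 0" for x
  proof -
    have "1 + x\<^sup>2 / 2 \<le> exp (x\<^sup>2 / 2)" by (rule exp_ge_add_one_self)
    then have "x\<^sup>2 \<le> 2 * exp (x\<^sup>2 / 2)" by linarith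
    also have "\<dots> \<le> sqrt (2 * pi) * exp (x\<^sup>2 / 2)"
      using pi_gt3 by (intro mult_right_mono real_le_rsqrt) auto
    finally have "x\<^sup>2 \<le> sqrt (2 * pi) * exp (x\<^sup>2 / 2)" .
    then have "std_normal_density x * x\<^sup>2 \<le> 1"
      by (simp add: std_normal_density_def exp_minus field_simps)
    then show ?thesis
      using that by (simp add: G_def c_def norm_mult abs_mult field_simps power2_eq_square)
  qed
  have odd: "G (- x) = - G x" for x by (simp add: G_def c_def std_normal_density_def)
  have "(G \<longlongrightarrow> 0) at_top"
    by (rule Lim_null_comparison[of _ "\<lambda>x. 1 / \<bar>x\<bar>"])
       (auto intro!: eventually_mono[OF eventually_gt_at_top[of 0]] norm_G tendsto_divide_0[OF tendsto_const]
         filterlim_at_top_imp_at_infinity filterlim_compose[OF filterlim_abs_real] filterlim_ident)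
  moreover have "(G \<longlongrightarrow> 0) at_bot"
    unfolding filterlim_at_bot_mirror odd using tendsto_minus[OF calculation] by simp
  moreover have "isCont G' x" for x
    unfolding G'_def[abs_def] c_def std_normal_density_def cis_conv_exp by (intro continuous_intros) auto
  ultimately have "(LBINT x=-\<infinity>..\<infinity>. G' x) = 0 - 0"
    using G intG'
    by (intro interval_integral_FTC_integrable[where F=G])
       (simp_all add: ereal_tendsto_simps set_integrable_def)
  then have "(\<integral>x. G' x \<partial>lborel) = 0"
    by (simp add: interval_lebesgue_integral_def set_lebesgue_integral_def)
  then show ?thesis
    unfolding G'_def c_def
    using integrable_std_normal_moment_cis[of 0] integrable_std_normal_moment_cis[of 2]
    by (simp add: algebra_simps)
qed

text \<open>The right-hand side is the principal branch of \<open>(1 - \<i> * s)\<close> to the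
  power -1/2 in polar form. Both sides solve the linear equation with coefficient
  \<open>\<i> / (2 * (1 - \<i> * s))\<close> and equal 1 at 0.\<close>

lemma std_normal_chi_square_cis:
  "(\<integral>x. complex_of_real (std_normal_density x) * cis (s * x\<^sup>2 / 2) \<partial>lborel) =
   complex_of_real ((1 + s\<^sup>2) powr (- 1 / 4)) * cis (arctan s / 2)"
proof -
  define \<Phi> where "\<Phi> s = (\<integral>x. complex_of_real (std_normal_density x) * cis (s * x\<^sup>2 / 2) \<partial>lborel)" for s
  \<comment> \<open>The reciprocal of the claimed value. It solves the equation with the opposite
    coefficient, so \<open>\<Phi> s * E s\<close> is constant.\<close>
  define E where "E s = complex_of_real ((1 + s\<^sup>2) powr (1 / 4)) * cis (- (arctan s / 2))" for s
  have pos: "1 + s\<^sup>2 > 0" for s :: real by (simp add: add_pos_nonneg)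
  have nz: "1 - \<i> * of_real s \<noteq> 0" for s :: real by (simp add: complex_eq_iff)
  have d\<Phi>: "(\<Phi> has_vector_derivative (\<i> / (2 * (1 - \<i> * s)) * \<Phi> s)) (at s)" for s
  proof -
    have "(\<Phi> has_vector_derivative (\<integral>x. \<i> / 2 *
        (complex_of_real (std_normal_density x * x\<^sup>2) * cis (s * x\<^sup>2 / 2)) \<partial>lborel)) (at s)"
      unfolding \<Phi>_def[abs_def]
    proof (rule has_vector_derivative_integral_dominated)
      show "integrable lborel (\<lambda>x. complex_of_real (std_normal_density x) * cis (t * x\<^sup>2 / 2))" for t
        using integrable_std_normal_moment_cis[of 0] by simp
      show "integrable lborel (\<lambda>x. std_normal_density x * \<bar>x\<bar> ^ 2 / 2)"
        using integrable_std_normal_moment_abs[of 2] by simp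
      fix t x :: real
      have "((\<lambda>t. cis (t * x\<^sup>2 / 2)) has_vector_derivative (\<i> * of_real (x\<^sup>2 / 2) * cis (t * x\<^sup>2 / 2))) (at t)"
        by (rule has_vector_derivative_cis) (auto intro!: derivative_eq_intros)
      from has_vector_derivative_mult_right[OF this, of "complex_of_real (std_normal_density x)"]
      show "((\<lambda>t. complex_of_real (std_normal_density x) * cis (t * x\<^sup>2 / 2)) has_vector_derivative
          \<i> / 2 * (complex_of_real (std_normal_density x * x\<^sup>2) * cis (t * x\<^sup>2 / 2))) (at t)"
        by (simp add: algebra_simps)
    qed (auto simp: norm_mult norm_power)
    \<comment> \<open>Integration by parts expresses the second-moment integral through
      \<open>\<Phi>\<close> itself and so closes the differential equation.\<close>
    also have "(\<integral>x. \<i> / 2 * (complex_of_real (std_normal_density x * x\<^sup>2) * cis (s * x\<^sup>2 / 2)) \<partial>lborel) =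
        \<i> / (2 * (1 - \<i> * s)) * \<Phi> s"
      unfolding \<Phi>_def std_normal_chi_square_by_parts using nz[of s] by (simp add: field_simps)
    finally show ?thesis .
  qed
  have dE: "(E has_vector_derivative (- \<i> / (2 * (1 - \<i> * s)) * E s)) (at s)" for s
  proof -
    have "((\<lambda>s. (1 + s\<^sup>2) powr (1 / 4)) has_real_derivative
        (1 + s\<^sup>2) powr (1 / 4) * (s / (2 * (1 + s\<^sup>2)))) (at s)"
    proof -
      have "((\<lambda>s. 1 + s\<^sup>2) has_real_derivative 2 * s) (at s)" by (auto intro!: derivative_eq_intros)
      from DERIV_chain2[OF has_real_derivative_powr[OF pos] this] show ?thesis
        by (rule DERIV_cong) (use pos[of s] in \<open>simp only: powr_diff powr_one, simp add: field_simps\<close>)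
    qed
    then have 1: "((\<lambda>s. complex_of_real ((1 + s\<^sup>2) powr (1 / 4))) has_vector_derivative
        complex_of_real ((1 + s\<^sup>2) powr (1 / 4) * (s / (2 * (1 + s\<^sup>2))))) (at s)"
      by (intro has_vector_derivative_of_real) (simp add: has_real_derivative_iff_has_vector_derivative)
    have 2: "((\<lambda>s. cis (- (arctan s / 2))) has_vector_derivative
        (\<i> * of_real (- (1 / (2 * (1 + s\<^sup>2)))) * cis (- (arctan s / 2)))) (at s)"
    proof (rule has_vector_derivative_cis)
      have "((\<lambda>s. - (arctan s / 2)) has_real_derivative - (inverse (1 + s\<^sup>2) / 2)) (at s)"
        by (intro DERIV_minus DERIV_cdivide DERIV_arctan)
      then show "((\<lambda>s. - (arctan s / 2)) has_real_derivative - (1 / (2 * (1 + s\<^sup>2)))) (at s)"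
        by (simp only: inverse_eq_divide divide_divide_eq_left mult.commute)
    qed
    \<comment> \<open>The logarithmic derivative of \<open>E\<close>: the modulus gives the real
      part and the argument the imaginary part. They combine because
      \<open>1 + s\<^sup>2 = (1 - \<i> * s) * (1 + \<i> * s)\<close>.\<close>
    have "complex_of_real (s / (2 * (1 + s\<^sup>2))) + \<i> * of_real (- (1 / (2 * (1 + s\<^sup>2)))) =
        - \<i> / (2 * (1 - \<i> * s))"
    proof -
      have "2 + 2 * (s * s) > 0" "4 + 4 * (s * s) > 0" by (simp_all add: add_pos_nonneg)
      then show ?thesis
        by (simp add: complex_eq_iff Re_divide Im_divide power2_eq_square frac_eq_eq)
    qed
    note eq = this
    have "of_real p * (\<i> * of_real r' * c) + of_real (p * r) * c =
        (of_real r + \<i> * of_real r') * (of_real p * c)" for p r r' :: real and c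
      by (simp add: algebra_simps)
    from has_vector_derivative_mult[OF 1 2, unfolded this eq] show ?thesis
      unfolding E_def[abs_def] .
  qed
  have "((\<lambda>s. \<Phi> s * E s) has_vector_derivative 0) (at s)" for s
    using has_vector_derivative_mult[OF d\<Phi> dE, of s] by (simp add: algebra_simps)
  then obtain c where c: "\<And>s. \<Phi> s * E s = c"
    using has_vector_derivative_zero_constant[of UNIV "\<lambda>s. \<Phi> s * E s"] by auto
  have "\<Phi> s * E s = \<Phi> 0 * E 0" by (simp only: c)
  also have "\<dots> = 1" by (simp add: \<Phi>_def E_def)
  finally have 1: "\<Phi> s * E s = 1" .
  have "E s * (complex_of_real ((1 + s\<^sup>2) powr (- 1 / 4)) * cis (arctan s / 2)) =
     of_real ((1 + s\<^sup>2) powr (1 / 4) * (1 + s\<^sup>2) powr (- 1 / 4)) * (cis (- (arctan s / 2)) * cis (arctan s / 2))"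
    unfolding E_def by (simp add: algebra_simps)
  also have "\<dots> = 1"
    using pos[of s] by (simp add: cis_mult flip: powr_add)
  finally have "\<Phi> s = \<Phi> s * (E s * (complex_of_real ((1 + s\<^sup>2) powr (- 1 / 4)) * cis (arctan s / 2)))"
    by simp
  also have "\<dots> = complex_of_real ((1 + s\<^sup>2) powr (- 1 / 4)) * cis (arctan s / 2)"
    by (simp only: mult.assoc[symmetric] 1 mult_1)
  finally show ?thesis by (simp only: \<Phi>_def)
qed

section \<open>Inversion formula for the sign of a random variable\<close>

text \<open>Lebesgue measure is the image of a product of one-dimensional Lebesgue measures under
  the coordinate map (\<open>lborel_eq\<close>), so Fubini factors the integral.\<close>

lemma
  fixes f :: "'a::euclidean_space \<Rightarrow> real \<Rightarrow> 'b::{real_normed_field, banach, second_countable_topology}"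
  assumes f: "\<And>b. b \<in> Basis \<Longrightarrow> integrable lborel (f b)"
  shows integrable_lborel_prod: "integrable lborel (\<lambda>x. \<Prod>b\<in>Basis. f b (x \<bullet> b))"
    and integral_lborel_prod:
      "(\<integral>x. (\<Prod>b\<in>Basis. f b (x \<bullet> b)) \<partial>lborel) = (\<Prod>b\<in>Basis. \<integral>x. f b x \<partial>lborel)"
proof -
  interpret product_sigma_finite "\<lambda>_ :: 'a. lborel :: real measure" by standard
  have [measurable]: "f b \<in> borel_measurable borel" if "b \<in> Basis" for b
    using f[OF that] by (simp add: borel_measurable_integrable[of lborel, simplified])
  have m: "(\<lambda>x. \<Prod>b\<in>Basis. f b (x \<bullet> b)) \<in> borel_measurable borel" by measurable
  have c: "(\<Prod>b\<in>Basis. f b ((\<Sum>b\<in>Basis. g b *\<^sub>R b) \<bullet> b)) = (\<Prod>b\<in>Basis. f b (g b))" for g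
    by (intro prod.cong) auto
  show "integrable lborel (\<lambda>x. \<Prod>b\<in>Basis. f b (x \<bullet> b))"
    unfolding lborel_eq[where 'a='a] using m f by (subst integrable_distr_eq) (auto simp: c intro!: product_integrable_prod)
  show "(\<integral>x. (\<Prod>b\<in>Basis. f b (x \<bullet> b)) \<partial>lborel) = (\<Prod>b\<in>Basis. \<integral>x. f b x \<partial>lborel)"
    unfolding lborel_eq[where 'a='a] using m f by (subst integral_distr) (auto simp: c product_integral_prod)
qed

text \<open>Fubini rewrites the truncated integral as the expectation of
  \<open>sgn (X x) * Si (T * \<bar>X x\<bar>)\<close>; \<open>Si\<close> is bounded and tends to
  \<open>pi / 2\<close>, so dominated convergence applies. Fubini is used on a bounded interval,
  where the integrand is at most \<open>\<bar>X x\<bar>\<close>; integrability of \<open>X\<close>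
  enters there.\<close>

lemma (in prob_space) tendsto_integral_sin_div:
  fixes X :: "'a \<Rightarrow> real"
  assumes X: "integrable M X"
  shows "((\<lambda>T. LBINT t:{0<..<T}. (\<integral>x. sin (t * X x) \<partial>M) / t) \<longlongrightarrow> pi / 2 * (\<integral>x. sgn (X x) \<partial>M)) at_top"
proof -
  have [measurable]: "X \<in> borel_measurable M" using X by simp
  interpret P: pair_sigma_finite M "lborel :: real measure" by standard
  have eq: "(LBINT t:{0<..<T}. (\<integral>x. sin (t * X x) \<partial>M) / t) = (\<integral>x. sgn (X x) * Si (T * \<bar>X x\<bar>) \<partial>M)"
    if T: "T \<ge> 0" for T
  proof -
    define h where "h x t = indicator {0<..<T} t * (sin (t * X x) / t)" for x t
    have le: "\<bar>h x t\<bar> \<le> indicator {0<..<T} t * \<bar>X x\<bar>" for x t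
      using abs_sin_x_le_abs_x[of "t * X x"]
      by (auto simp: h_def indicator_def abs_mult divide_le_eq mult.commute)
    have m: "case_prod h \<in> borel_measurable (M \<Otimes>\<^sub>M lborel)" unfolding h_def by measurable
    have int: "integrable lborel (h x)" for x
    proof (rule Bochner_Integration.integrable_bound)
      show "integrable lborel (\<lambda>t. indicator {0<..<T} t * \<bar>X x\<bar>)" using T by simp
      show "h x \<in> borel_measurable lborel" unfolding h_def by measurable
    qed (use le in auto)
    have "integrable (M \<Otimes>\<^sub>M lborel) (case_prod h)"
    proof (rule P.Fubini_integrable[OF m])
      show "integrable M (\<lambda>x. \<integral>t. norm (case_prod h (x, t)) \<partial>lborel)"
      proof (rule Bochner_Integration.integrable_bound)
        show "integrable M (\<lambda>x. T * \<bar>X x\<bar>)" using X by simp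
        show "(\<lambda>x. \<integral>t. norm (case_prod h (x, t)) \<partial>lborel) \<in> borel_measurable M"
          using m by measurable
        show "AE x in M. norm (\<integral>t. norm (case_prod h (x, t)) \<partial>lborel) \<le> norm (T * \<bar>X x\<bar>)"
        proof (rule AE_I2)
          fix x
          have "(\<integral>t. \<bar>h x t\<bar> \<partial>lborel) \<le> (\<integral>t. indicator {0<..<T} t * \<bar>X x\<bar> \<partial>lborel)"
            using int le T by (intro integral_mono) auto
          also have "\<dots> = T * \<bar>X x\<bar>" using T by simp
          finally show "norm (\<integral>t. norm (case_prod h (x, t)) \<partial>lborel) \<le> norm (T * \<bar>X x\<bar>)"
            using T by simp
        qed
      qed
    qed (use int in auto)
    note int_h = this
    have inner: "(\<integral>t. h x t \<partial>lborel) = sgn (X x) * Si (T * \<bar>X x\<bar>)" for x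
      using LBINT_I0c_sin_scale_divide[OF T, of "X x"] T
      by (simp add: h_def interval_lebesgue_integral_def set_lebesgue_integral_def zero_ereal_def)
    from P.Fubini_integral[OF int_h]
    have "(\<integral>t. (\<integral>x. h x t \<partial>M) \<partial>lborel) = (\<integral>x. (\<integral>t. h x t \<partial>lborel) \<partial>M)" .
    also have "(\<integral>t. (\<integral>x. h x t \<partial>M) \<partial>lborel) = (LBINT t:{0<..<T}. (\<integral>x. sin (t * X x) \<partial>M) / t)"
      by (simp add: h_def set_lebesgue_integral_def)
    finally show ?thesis by (simp add: inner)
  qed
  obtain B where B: "\<And>T. \<bar>Si T\<bar> \<le> B" using bounded_Si by blast
  have "((\<lambda>T. \<integral>x. sgn (X x) * Si (T * \<bar>X x\<bar>) \<partial>M) \<longlongrightarrow> (\<integral>x. sgn (X x) * (pi / 2) \<partial>M)) at_top"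
  proof (rule integral_dominated_convergence_at_top[where w="\<lambda>_. B"])
    show "AE x in M. ((\<lambda>T. sgn (X x) * Si (T * \<bar>X x\<bar>)) \<longlongrightarrow> sgn (X x) * (pi / 2)) at_top"
    proof (rule AE_I2)
      fix x
      show "((\<lambda>T. sgn (X x) * Si (T * \<bar>X x\<bar>)) \<longlongrightarrow> sgn (X x) * (pi / 2)) at_top"
      proof (cases "X x = 0")
        case False
        then have "filterlim (\<lambda>T. T * \<bar>X x\<bar>) at_top at_top"
          by (intro filterlim_at_top_mult_tendsto_pos[OF tendsto_const] filterlim_ident) auto
        then show ?thesis by (intro tendsto_mult tendsto_const filterlim_compose[OF Si_at_top])
      qed simp
    qed
    have "\<bar>sgn (X x)\<bar> * \<bar>Si z\<bar> \<le> B" for x z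
      using B[of z] by (auto simp: sgn_if)
    then show "\<forall>\<^sub>F T in at_top. AE x in M. norm (sgn (X x) * Si (T * \<bar>X x\<bar>)) \<le> B"
      by (simp add: abs_mult)
  qed auto
  then have "((\<lambda>T. \<integral>x. sgn (X x) * Si (T * \<bar>X x\<bar>) \<partial>M) \<longlongrightarrow> pi / 2 * (\<integral>x. sgn (X x) \<partial>M)) at_top"
    by (simp add: mult.commute)
  then show ?thesis
    by (rule Lim_transform_eventually) (auto intro!: eventually_mono[OF eventually_ge_at_top[of 0]] simp: eq)
qed

text \<open>Dominated convergence with majorant \<open>norm (g t)\<close>. It identifies the limit
  in the inversion formula with a Lebesgue integral over the half-line.\<close>

lemma tendsto_set_integral_Ioo_at_top:
  fixes f :: "real \<Rightarrow> real"
  assumes "set_integrable lborel {0<..} f"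
  shows "((\<lambda>T. LBINT t:{0<..<T}. f t) \<longlongrightarrow> (LBINT t:{0<..}. f t)) at_top"
proof -
  define g where "g t = indicator {0<..} t *\<^sub>R f t" for t
  have g: "integrable lborel g" using assms by (simp add: set_integrable_def g_def[abs_def])
  have "((\<lambda>T. \<integral>t. indicator {..<T} t *\<^sub>R g t \<partial>lborel) \<longlongrightarrow> (\<integral>t. g t \<partial>lborel)) at_top"
  proof (rule integral_dominated_convergence_at_top[where w="\<lambda>t. norm (g t)"])
    show "AE t in lborel. ((\<lambda>T. indicator {..<T} t *\<^sub>R g t) \<longlongrightarrow> g t) at_top"
    proof (rule AE_I2)
      fix t :: real
      show "((\<lambda>T. indicator {..<T} t *\<^sub>R g t) \<longlongrightarrow> g t) at_top"
        by (intro tendsto_eventually eventually_mono[OF eventually_gt_at_top[of t]]) auto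
    qed
  qed (use g in \<open>auto simp: indicator_def borel_measurable_integrable\<close>)
  moreover have "indicator {..<T} t *\<^sub>R g t = indicator {0<..<T} t *\<^sub>R f t" for T t
    by (auto simp: g_def indicator_def)
  ultimately show ?thesis unfolding set_lebesgue_integral_def g_def[symmetric] by (simp only:)
qed

lemma set_integrable_powr_minus_three_halves:
  "set_integrable lborel {1..} (\<lambda>u::real. u powr (- 3 / 2))"
proof -
  have "(\<integral>\<^sup>+u. ennreal ((\<lambda>u. u powr (- 3 / 2)) u) * indicator {1::real..} u \<partial>lborel) =
      ennreal (0 - (- 2 * 1 powr (- 1 / 2)))"
  proof (rule nn_integral_FTC_atLeast[where F="\<lambda>u. - 2 * u powr (- 1 / 2)"])
    show "((\<lambda>u. - 2 * u powr (- 1 / 2)) has_real_derivative u powr (- 3 / 2)) (at u)" if "1 \<le> u" for u :: real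
      using that DERIV_cmult[OF has_real_derivative_powr[of u "- 1 / 2"], of "- 2"] by simp
    have "((\<lambda>u. - 2 * u powr (- 1 / 2)) \<longlongrightarrow> - 2 * 0) (at_top :: real filter)"
      by (intro tendsto_mult tendsto_const tendsto_neg_powr filterlim_ident) auto
    then show "((\<lambda>u. - 2 * u powr (- 1 / 2)) \<longlongrightarrow> 0) (at_top :: real filter)" by simp
  qed auto
  then have "(\<integral>\<^sup>+u. ennreal (indicator {1..} u * u powr (- 3 / 2)) \<partial>lborel) < \<infinity>"
    by (simp add: ennreal_mult' ennreal_indicator mult.commute flip: ennreal_mult'')
  then show ?thesis
    unfolding set_integrable_def by (intro integrableI_nonneg) auto
qed

text \<open>Near 0 the sine is at most a constant times \<open>u\<close>, which cancels the pole. At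
  infinity the single nonzero coefficient \<open>a k\<close> makes the product grow at least like
  the square root of \<open>u\<close>, so the integrand decays like
  \<open>u powr (- 3 / 2)\<close>.\<close>

lemma set_integrable_imhof:
  fixes a :: "'i \<Rightarrow> real"
  assumes I: "finite I" "k \<in> I" "a k \<noteq> 0"
  shows "set_integrable lborel {0<..} (\<lambda>u. sin (1 / 2 * (\<Sum>i\<in>I. arctan (a i * u))) /
      (u * (\<Prod>i\<in>I. (1 + (a i)\<^sup>2 * u\<^sup>2) powr (1 / 4))))"
proof -
  define f where "f u = sin (1 / 2 * (\<Sum>i\<in>I. arctan (a i * u))) /
      (u * (\<Prod>i\<in>I. (1 + (a i)\<^sup>2 * u\<^sup>2) powr (1 / 4)))" for u
  define C where "C = (\<Sum>i\<in>I. \<bar>a i\<bar>)"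
  \<comment> \<open>The indicators overlap at \<open>u = 1\<close>, where the additional nonnegative
    term only enlarges the majorant.\<close>
  define w where "w u = C * indicator {0..1} u + \<bar>a k\<bar> powr (- 1 / 2) * (indicator {1..} u *\<^sub>R u powr (- 3 / 2))" for u :: real
  have C: "C \<ge> 0" by (simp add: C_def sum_nonneg)
  have w: "integrable lborel w"
    unfolding w_def using set_integrable_powr_minus_three_halves unfolding set_integrable_def by simp
  have bound: "\<bar>f u\<bar> \<le> w u" if u: "u > 0" for u
  proof (cases "u \<le> 1")
    case True
    have "1 \<le> (\<Prod>i\<in>I. (1 + (a i)\<^sup>2 * u\<^sup>2) powr (1 / 4))"
      by (intro prod_ge_1 ge_one_powr_ge_zero) auto
    then have den: "u \<le> u * (\<Prod>i\<in>I. (1 + (a i)\<^sup>2 * u\<^sup>2) powr (1 / 4))" using u by simp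
    have "\<bar>sin (1 / 2 * (\<Sum>i\<in>I. arctan (a i * u)))\<bar> \<le> \<bar>\<Sum>i\<in>I. arctan (a i * u)\<bar>"
      using abs_sin_x_le_abs_x[of "1 / 2 * (\<Sum>i\<in>I. arctan (a i * u))"] by simp
    also have "\<dots> \<le> (\<Sum>i\<in>I. \<bar>a i * u\<bar>)"
      by (intro order_trans[OF sum_abs] sum_mono abs_arctan_le)
    also have "\<dots> = C * u" using u by (simp add: C_def sum_distrib_right abs_mult)
    finally have "\<bar>f u\<bar> \<le> C * u / u"
      using u den C unfolding f_def abs_divide by (intro frac_le) auto
    also have "\<dots> \<le> w u" using u True by (simp add: w_def)
    finally show ?thesis .
  next
    case False
    have "\<bar>a k\<bar> powr (1 / 2) * u powr (1 / 2) = ((a k)\<^sup>2 * u\<^sup>2) powr (1 / 4)"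
    proof -
      have "(a k)\<^sup>2 * u\<^sup>2 = (\<bar>a k\<bar> * u) powr 2" using u I(3) by (simp add: power_mult_distrib)
      then have "((a k)\<^sup>2 * u\<^sup>2) powr (1 / 4) = (\<bar>a k\<bar> * u) powr (1 / 2)"
        by (simp only: powr_powr) simp
      then show ?thesis using u by (simp add: powr_mult)
    qed
    also have "\<dots> \<le> (1 + (a k)\<^sup>2 * u\<^sup>2) powr (1 / 4)" by (intro powr_mono2) auto
    also have "\<dots> \<le> (\<Prod>i\<in>I. (1 + (a i)\<^sup>2 * u\<^sup>2) powr (1 / 4))"
    proof -
      have "1 \<le> (\<Prod>i\<in>I - {k}. (1 + (a i)\<^sup>2 * u\<^sup>2) powr (1 / 4))"
        by (intro prod_ge_1 ge_one_powr_ge_zero) auto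
      then show ?thesis using I by (simp add: prod.remove[of I k] mult_le_cancel_left1)
    qed
    finally have den: "\<bar>a k\<bar> powr (1 / 2) * u powr (1 / 2) \<le> (\<Prod>i\<in>I. (1 + (a i)\<^sup>2 * u\<^sup>2) powr (1 / 4))" .
    have "\<bar>f u\<bar> \<le> 1 / (u * (\<bar>a k\<bar> powr (1 / 2) * u powr (1 / 2)))"
      using u den I(3) unfolding f_def abs_divide by (intro frac_le mult_pos_pos) (auto simp: abs_mult)
    also have "\<dots> = \<bar>a k\<bar> powr (- 1 / 2) * u powr (- 3 / 2)"
      using powr_minus_divide[of u "3 / 2"] powr_minus_divide[of "\<bar>a k\<bar>" "1 / 2"] u
        powr_add[of u 1 "1 / 2"] by simp
    also have "\<dots> = w u" using False by (simp add: w_def)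
    finally show ?thesis .
  qed
  have "integrable lborel (\<lambda>u. indicator {0<..} u *\<^sub>R f u)"
  proof (rule Bochner_Integration.integrable_bound[OF w])
    show "(\<lambda>u. indicator {0<..} u *\<^sub>R f u) \<in> borel_measurable lborel"
      unfolding f_def by measurable
    show "AE u in lborel. norm (indicator {0<..} u *\<^sub>R f u) \<le> norm (w u)"
      using bound by (auto simp: indicator_def intro: order_trans[OF _ abs_ge_self])
  qed
  then show ?thesis by (simp add: set_integrable_def f_def)
qed

section \<open>Quadratic forms of Gaussian vectors\<close>

definition std_gaussian :: "'a::euclidean_space measure" where
  "std_gaussian = density lborel (\<lambda>x. ennreal (\<Prod>b\<in>Basis. std_normal_density (x \<bullet> b)))"

lemma sets_std_gaussian [measurable_cong, simp]: "sets std_gaussian = sets borel"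
  and space_std_gaussian [simp]: "space std_gaussian = UNIV"
  by (simp_all add: std_gaussian_def)

lemma prob_space_std_gaussian: "prob_space (std_gaussian :: 'a::euclidean_space measure)"
proof
  have "(\<integral>\<^sup>+x. ennreal (std_normal_density x) \<partial>lborel) = 1"
    by (subst nn_integral_eq_integral) (auto simp: normal_density_nonneg)
  then have "(\<integral>\<^sup>+x. (\<Prod>b\<in>Basis. ennreal (std_normal_density (x \<bullet> b))) \<partial>(lborel :: 'a measure)) = 1"
    by (subst nn_integral_lborel_prod) auto
  then show "emeasure (std_gaussian :: 'a measure) (space std_gaussian) = 1"
    by (simp add: std_gaussian_def emeasure_density prod_ennreal)
qed

text \<open>The product form of the density serves Fubini; this radial form serves the comparison
  with the unit ball.\<close>

lemma std_gaussian_density: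
  fixes x :: "'a::euclidean_space"
  shows "(\<Prod>b\<in>Basis. std_normal_density (x \<bullet> b)) = (1 / sqrt (2 * pi)) ^ DIM('a) * exp (- ((norm x)\<^sup>2 / 2))"
proof -
  have "(norm x)\<^sup>2 = (\<Sum>b\<in>Basis. (x \<bullet> b)\<^sup>2)"
    unfolding power2_norm_eq_inner by (subst euclidean_inner) (simp add: power2_eq_square)
  then have "exp (- ((norm x)\<^sup>2 / 2)) = exp (\<Sum>b\<in>Basis. - ((x \<bullet> b)\<^sup>2 / 2))"
    by (simp add: sum_negf sum_divide_distrib)
  then show ?thesis
    by (simp add: std_normal_density_def prod.distrib exp_sum prod_dividef power_one_over)
qed

lemma prod_cis: "(\<Prod>i\<in>I. cis (f i)) = cis (\<Sum>i\<in>I. f i)"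
  by (induction I rule: infinite_finite_induct) (auto simp: cis_mult)

text \<open>The exponential of a sum factors over the coordinates, and each factor is the
  one-dimensional formula at \<open>s = a b * u\<close>.\<close>

lemma integral_std_gaussian_cis:
  fixes a :: "'a::euclidean_space \<Rightarrow> real"
  shows "(\<integral>x. cis (u * ((\<Sum>b\<in>Basis. a b * (x \<bullet> b)\<^sup>2) / 2)) \<partial>std_gaussian) =
    complex_of_real (\<Prod>b\<in>Basis. (1 + (a b)\<^sup>2 * u\<^sup>2) powr (- 1 / 4)) *
    cis (1 / 2 * (\<Sum>b\<in>Basis. arctan (a b * u)))"
proof -
  define f where "f b x = complex_of_real (std_normal_density x) * cis (a b * u * x\<^sup>2 / 2)" for b x
  have int: "integrable lborel (f b)" for b
    unfolding f_def using integrable_std_normal_moment_cis[of 0] by simp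
  have "(\<integral>x. cis (u * ((\<Sum>b\<in>Basis. a b * (x \<bullet> b)\<^sup>2) / 2)) \<partial>std_gaussian) =
      (\<integral>x. (\<Prod>b\<in>Basis. std_normal_density (x \<bullet> b)) *\<^sub>R
        cis (u * ((\<Sum>b\<in>Basis. a b * (x \<bullet> b)\<^sup>2) / 2)) \<partial>(lborel :: 'a measure))"
    unfolding std_gaussian_def by (subst integral_density) (auto intro!: AE_I2 prod_nonneg)
  also have "\<dots> = (\<integral>x. (\<Prod>b\<in>Basis. f b (x \<bullet> b)) \<partial>(lborel :: 'a measure))"
  proof (rule Bochner_Integration.integral_cong)
    fix x :: 'a
    have "cis (u * ((\<Sum>b\<in>Basis. a b * (x \<bullet> b)\<^sup>2) / 2)) = (\<Prod>b\<in>Basis. cis (a b * u * (x \<bullet> b)\<^sup>2 / 2))"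
      by (simp add: prod_cis sum_distrib_left sum_divide_distrib mult_ac)
    then show "(\<Prod>b\<in>Basis. std_normal_density (x \<bullet> b)) *\<^sub>R
        cis (u * ((\<Sum>b\<in>Basis. a b * (x \<bullet> b)\<^sup>2) / 2)) = (\<Prod>b\<in>Basis. f b (x \<bullet> b))"
      by (simp add: f_def prod.distrib scaleR_conv_of_real)
  qed simp
  also have "\<dots> = (\<Prod>b\<in>Basis. \<integral>x. f b x \<partial>lborel)"
    using int by (rule integral_lborel_prod)
  also have "\<dots> = (\<Prod>b\<in>Basis. complex_of_real ((1 + (a b)\<^sup>2 * u\<^sup>2) powr (- 1 / 4)) * cis (arctan (a b * u) / 2))"
    unfolding f_def std_normal_chi_square_cis by (simp add: power_mult_distrib)
  also have "\<dots> = complex_of_real (\<Prod>b\<in>Basis. (1 + (a b)\<^sup>2 * u\<^sup>2) powr (- 1 / 4)) *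
      cis (1 / 2 * (\<Sum>b\<in>Basis. arctan (a b * u)))"
    by (simp add: prod.distrib prod_cis sum_divide_distrib)
  finally show ?thesis .
qed

lemma integral_std_gaussian_sin:
  fixes a :: "'a::euclidean_space \<Rightarrow> real"
  shows "(\<integral>x. sin (u * ((\<Sum>b\<in>Basis. a b * (x \<bullet> b)\<^sup>2) / 2)) \<partial>std_gaussian) =
    sin (1 / 2 * (\<Sum>b\<in>Basis. arctan (a b * u))) / (\<Prod>b\<in>Basis. (1 + (a b)\<^sup>2 * u\<^sup>2) powr (1 / 4))"
proof -
  interpret prob_space "std_gaussian :: 'a measure" by (rule prob_space_std_gaussian)
  have "integrable std_gaussian (\<lambda>x::'a. cis (u * ((\<Sum>b\<in>Basis. a b * (x \<bullet> b)\<^sup>2) / 2)))"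
    by (intro integrable_const_bound[of _ 1]) auto
  from integral_Im[OF this]
  have "(\<integral>x. sin (u * ((\<Sum>b\<in>Basis. a b * (x \<bullet> b)\<^sup>2) / 2)) \<partial>std_gaussian) =
    Im (\<integral>x. cis (u * ((\<Sum>b\<in>Basis. a b * (x \<bullet> b)\<^sup>2) / 2)) \<partial>std_gaussian)" by simp
  then show ?thesis
    unfolding integral_std_gaussian_cis by (simp add: powr_minus_divide prod_dividef del: of_real_prod)
qed

lemma integrable_std_gaussian_quadratic:
  fixes a :: "'a::euclidean_space \<Rightarrow> real"
  shows "integrable std_gaussian (\<lambda>x::'a. (\<Sum>b\<in>Basis. a b * (x \<bullet> b)\<^sup>2) / 2)"
proof -
  have "integrable std_gaussian (\<lambda>x::'a. (x \<bullet> b)\<^sup>2)" if b: "b \<in> Basis" for b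
  proof -
    \<comment> \<open>The second moment is placed in coordinate \<open>b\<close> alone; every other
      coordinate contributes only its density.\<close>
    define f where "f c x = std_normal_density x * (if c = b then x\<^sup>2 else 1)" for c :: 'a and x
    have "integrable lborel (f c)" for c
      unfolding f_def using integrable_std_normal_moment[of 2] by (cases "c = b") auto
    then have "integrable lborel (\<lambda>x::'a. \<Prod>c\<in>Basis. f c (x \<bullet> c))"
      by (rule integrable_lborel_prod)
    also have "(\<lambda>x::'a. \<Prod>c\<in>Basis. f c (x \<bullet> c)) =
        (\<lambda>x. (\<Prod>c\<in>Basis. std_normal_density (x \<bullet> c)) *\<^sub>R (x \<bullet> b)\<^sup>2)"
      using b by (simp add: f_def prod.distrib)
    finally show ?thesis
      unfolding std_gaussian_def by (subst integrable_density) (auto intro!: AE_I2 prod_nonneg)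
  qed
  then show ?thesis by auto
qed

text \<open>Average the translates of \<open>N\<close> along \<open>t *\<^sub>R v\<close> for
  \<open>t\<close> in the unit interval. Translation invariance leaves the measure unchanged, while
  integrating over \<open>t\<close> first meets only null sections.\<close>

lemma emeasure_lborel_eq_0_of_lines:
  fixes v :: "'a::euclidean_space"
  assumes N [measurable]: "N \<in> sets borel"
    and line: "\<And>x. emeasure lborel {t::real. x + t *\<^sub>R v \<in> N} = 0"
  shows "emeasure lborel N = 0"
proof -
  have "emeasure lborel N = (\<integral>\<^sup>+t. emeasure lborel N * indicator {0..1::real} t \<partial>lborel)"
    by (simp add: nn_integral_cmult)
  also have "\<dots> = (\<integral>\<^sup>+t. (\<integral>\<^sup>+x. indicator N (x + t *\<^sub>R v) * indicator {0..1} t \<partial>lborel) \<partial>lborel)"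
  proof (rule nn_integral_cong)
    fix t :: real
    have "emeasure lborel N = (\<integral>\<^sup>+x. indicator N x \<partial>distr lborel borel ((+) (t *\<^sub>R v)))"
      by (simp add: lborel_distr_plus)
    also have "\<dots> = (\<integral>\<^sup>+x. indicator N (x + t *\<^sub>R v) \<partial>lborel)"
      by (subst nn_integral_distr) (auto simp: add.commute)
    finally show "emeasure lborel N * indicator {0..1} t =
        (\<integral>\<^sup>+x. indicator N (x + t *\<^sub>R v) * indicator {0..1} t \<partial>lborel)"
      by (simp add: nn_integral_multc)
  qed
  also have "\<dots> = (\<integral>\<^sup>+x. (\<integral>\<^sup>+t. indicator N (x + t *\<^sub>R v) * indicator {0..1} t \<partial>lborel) \<partial>lborel)"
    by (rule lborel_pair.Fubini') measurable
  also have "\<dots> = 0"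
  proof -
    have "(\<integral>\<^sup>+t. indicator N (x + t *\<^sub>R v) * indicator {0..1::real} t \<partial>lborel) = 0" for x
    proof -
      have "(\<integral>\<^sup>+t. indicator N (x + t *\<^sub>R v) * indicator {0..1::real} t \<partial>lborel) \<le>
          (\<integral>\<^sup>+t. indicator {t. x + t *\<^sub>R v \<in> N} t \<partial>lborel)"
        by (intro nn_integral_mono) (auto simp: indicator_def)
      also have "\<dots> = emeasure lborel {t::real. x + t *\<^sub>R v \<in> N}"
        by (rule nn_integral_indicator) measurable
      finally show ?thesis using line[of x] by simp
    qed
    then show ?thesis by simp
  qed
  finally show ?thesis .
qed

text \<open>On a line in direction \<open>k\<close> the form is a quadratic polynomial in
  \<open>t\<close> with leading coefficient \<open>a k\<close>, so the line meets the quadric in at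
  most two points.\<close>

lemma emeasure_lborel_quadric:
  fixes a :: "'a::euclidean_space \<Rightarrow> real"
  assumes k: "k \<in> Basis" "a k \<noteq> 0"
  shows "emeasure lborel {x. (\<Sum>b\<in>Basis. a b * (x \<bullet> b)\<^sup>2) = 0} = 0"
proof (rule emeasure_lborel_eq_0_of_lines[where v=k])
  fix x :: 'a
  define r where "r = (\<Sum>b\<in>Basis - {k}. a b * (x \<bullet> b)\<^sup>2)"
  \<comment> \<open>If \<open>- r / a k\<close> is negative, the section is empty and the inclusion
    below holds vacuously.\<close>
  define c where "c = sqrt (- r / a k)"
  have "{t. x + t *\<^sub>R k \<in> {x. (\<Sum>b\<in>Basis. a b * (x \<bullet> b)\<^sup>2) = 0}} \<subseteq> {c - x \<bullet> k, - c - x \<bullet> k}"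
  proof
    fix t assume "t \<in> {t. x + t *\<^sub>R k \<in> {x. (\<Sum>b\<in>Basis. a b * (x \<bullet> b)\<^sup>2) = 0}}"
    then have "(\<Sum>b\<in>Basis. a b * ((x + t *\<^sub>R k) \<bullet> b)\<^sup>2) = 0" by simp
    also have "(\<Sum>b\<in>Basis. a b * ((x + t *\<^sub>R k) \<bullet> b)\<^sup>2) = a k * (x \<bullet> k + t)\<^sup>2 + r"
      unfolding r_def using k
      by (auto simp: sum.remove[of Basis k] inner_add_left inner_Basis intro!: sum.cong split: if_splits)
    finally have "(x \<bullet> k + t)\<^sup>2 = - r / a k" using k by (simp add: field_simps)
    then have "c = \<bar>x \<bullet> k + t\<bar>" by (simp add: c_def flip: real_sqrt_abs)
    then show "t \<in> {c - x \<bullet> k, - c - x \<bullet> k}" by (auto simp: abs_if split: if_splits)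
  qed
  then have "finite {t. x + t *\<^sub>R k \<in> {x. (\<Sum>b\<in>Basis. a b * (x \<bullet> b)\<^sup>2) = 0}}"
    by (rule finite_subset) simp
  then show "emeasure lborel {t. x + t *\<^sub>R k \<in> {x. (\<Sum>b\<in>Basis. a b * (x \<bullet> b)\<^sup>2) = 0}} = 0"
    by (rule emeasure_lborel_countable[OF countable_finite])
qed measurable

text \<open>The inversion formula gives the difference of the two probabilities as
  \<open>2 / pi * J\<close>; their sum is 1 because the zero set of the form is null. The two
  equations determine both.\<close>

lemma
  fixes a :: "'a::euclidean_space \<Rightarrow> real"
  assumes k: "k \<in> Basis" "a k \<noteq> 0"
  defines "J \<equiv> LBINT u:{0<..}. sin (1 / 2 * (\<Sum>b\<in>Basis. arctan (a b * u))) /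
      (u * (\<Prod>b\<in>Basis. (1 + (a b)\<^sup>2 * u\<^sup>2) powr (1 / 4)))"
  shows std_gaussian_quadratic_pos:
      "measure std_gaussian {x. (\<Sum>b\<in>Basis. a b * (x \<bullet> b)\<^sup>2) > 0} = 1 / 2 + 1 / pi * J"
    and std_gaussian_quadratic_neg:
      "measure std_gaussian {x. (\<Sum>b\<in>Basis. a b * (x \<bullet> b)\<^sup>2) < 0} = 1 / 2 - 1 / pi * J"
proof -
  interpret prob_space "std_gaussian :: 'a measure" by (rule prob_space_std_gaussian)
  define Q where "Q x = (\<Sum>b\<in>Basis. a b * (x \<bullet> b)\<^sup>2)" for x :: 'a
  have [measurable]: "Q \<in> borel_measurable borel" unfolding Q_def by measurable
  have int: "set_integrable lborel {0<..} (\<lambda>u. sin (1 / 2 * (\<Sum>b\<in>Basis. arctan (a b * u))) /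
      (u * (\<Prod>b\<in>Basis. (1 + (a b)\<^sup>2 * u\<^sup>2) powr (1 / 4))))"
    using k by (intro set_integrable_imhof) auto
  have "((\<lambda>T. LBINT u:{0<..<T}. (\<integral>x. sin (u * (Q x / 2)) \<partial>std_gaussian) / u)
      \<longlongrightarrow> pi / 2 * (\<integral>x. sgn (Q x / 2) \<partial>std_gaussian)) at_top"
    unfolding Q_def by (rule tendsto_integral_sin_div[OF integrable_std_gaussian_quadratic])
  moreover have "((\<lambda>T. LBINT u:{0<..<T}. (\<integral>x. sin (u * (Q x / 2)) \<partial>std_gaussian) / u) \<longlongrightarrow> J) at_top"
    unfolding Q_def integral_std_gaussian_sin J_def
    using tendsto_set_integral_Ioo_at_top[OF int] by (simp add: mult.commute)
  ultimately have J: "pi / 2 * (\<integral>x. sgn (Q x / 2) \<partial>std_gaussian) = J"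
    by (rule tendsto_unique[rotated]) simp
  have sgn: "sgn (Q x / 2) = indicator {x. Q x > 0} x - indicator {x. Q x < 0} x" for x
    by (auto simp: sgn_if indicator_def)
  have E_sgn: "(\<integral>x. sgn (Q x / 2) \<partial>std_gaussian) = prob {x. Q x > 0} - prob {x. Q x < 0}"
    unfolding sgn by (subst Bochner_Integration.integral_diff) (auto intro!: integrable_real_indicator simp: less_top[symmetric])
  have diff: "prob {x. Q x > 0} - prob {x. Q x < 0} = 2 / pi * J"
    using J unfolding E_sgn by (simp add: field_simps)
  have "emeasure lborel {x. Q x = 0} = 0"
    unfolding Q_def using k by (rule emeasure_lborel_quadric)
  then have "AE x in lborel. Q x \<noteq> 0"
    by (subst AE_iff_measurable[OF _ refl]) auto
  then have "AE x in std_gaussian. Q x \<noteq> 0"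
    unfolding std_gaussian_def by (subst AE_density) auto
  then have "prob ({x. Q x > 0} \<union> {x. Q x < 0}) = 1"
    by (subst prob_eq_1) (auto elim!: eventually_mono)
  then have sum: "prob {x. Q x > 0} + prob {x. Q x < 0} = 1"
    by (subst (asm) finite_measure_Union) auto
  show "measure std_gaussian {x. (\<Sum>b\<in>Basis. a b * (x \<bullet> b)\<^sup>2) > 0} = 1 / 2 + 1 / pi * J"
    using diff sum unfolding Q_def[symmetric] by simp
  show "measure std_gaussian {x. (\<Sum>b\<in>Basis. a b * (x \<bullet> b)\<^sup>2) < 0} = 1 / 2 - 1 / pi * J"
    using diff sum unfolding Q_def[symmetric] by simp
qed

section \<open>From the Gaussian to the unit sphere\<close>

text \<open>Dilation by \<open>r\<close> carries \<open>C \<inter> ball 0 1\<close> onto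
  \<open>C \<inter> ball 0 r\<close> and scales Lebesgue measure by
  \<open>r ^ DIM('a)\<close>.\<close>

lemma emeasure_cone_ball:
  fixes C :: "'a::euclidean_space set"
  assumes C [measurable]: "C \<in> sets borel" and cone: "\<And>c x. c > 0 \<Longrightarrow> c *\<^sub>R x \<in> C \<longleftrightarrow> x \<in> C"
    and r: "r > 0"
  shows "emeasure lborel (C \<inter> ball 0 r) = ennreal (r ^ DIM('a)) * emeasure lborel (C \<inter> ball 0 1)"
proof -
  have "(\<lambda>x. 0 + r *\<^sub>R x) -` (C \<inter> ball 0 r) = C \<inter> ball 0 1"
    using r cone by auto
  moreover have "emeasure lborel (C \<inter> ball 0 r) =
      ennreal (r ^ DIM('a)) * emeasure lborel ((\<lambda>x. 0 + r *\<^sub>R x) -` (C \<inter> ball 0 r))"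
    using r by (subst lborel_affine[of r 0]) (simp_all add: emeasure_density nn_integral_cmult_indicator emeasure_distr)
  ultimately show ?thesis by simp
qed

text \<open>With \<open>n = norm x\<close>, this writes the radial Gaussian factor as a
  superposition over \<open>r\<close> of the indicators of the balls of radius
  \<open>r\<close>.\<close>

lemma nn_integral_gaussian_tail:
  assumes "n \<ge> 0"
  shows "(\<integral>\<^sup>+r. ennreal (r * exp (- (r\<^sup>2 / 2))) * indicator {n<..} r \<partial>lborel) = ennreal (exp (- (n\<^sup>2 / 2)))"
proof -
  have "(\<integral>\<^sup>+r. ennreal (r * exp (- (r\<^sup>2 / 2))) * indicator {n<..} r \<partial>lborel) =
      (\<integral>\<^sup>+r. ennreal (r * exp (- (r\<^sup>2 / 2))) * indicator {n..} r \<partial>lborel)"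
    by (intro nn_integral_cong_AE eventually_mono[OF AE_lborel_singleton[of n]]) (auto simp: indicator_def)
  also have "\<dots> = ennreal (0 - (- exp (- (n\<^sup>2 / 2))))"
  proof (rule nn_integral_FTC_atLeast[where F="\<lambda>r. - exp (- (r\<^sup>2 / 2))"])
    show "((\<lambda>r. - exp (- (r\<^sup>2 / 2))) has_real_derivative r * exp (- (r\<^sup>2 / 2))) (at r)" for r :: real
      by (auto intro!: derivative_eq_intros)
    have "filterlim (\<lambda>r::real. 1 / 2 * r\<^sup>2) at_top at_top"
      by (intro filterlim_tendsto_pos_mult_at_top[OF tendsto_const] filterlim_pow_at_top filterlim_ident) auto
    from filterlim_compose[OF exp_at_bot filterlim_compose[OF filterlim_uminus_at_bot_at_top this]]
    have "((\<lambda>r::real. exp (- (r\<^sup>2 / 2))) \<longlongrightarrow> 0) at_top" by simp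
    from tendsto_minus[OF this] show "((\<lambda>r::real. - exp (- (r\<^sup>2 / 2))) \<longlongrightarrow> 0) at_top" by simp
  qed (use assms in auto)
  finally show ?thesis by simp
qed

text \<open>The Gaussian is a mixture of uniform distributions on balls around the origin.\<close>

lemma emeasure_std_gaussian_cone:
  fixes C :: "'a::euclidean_space set"
  assumes C [measurable]: "C \<in> sets borel" and cone: "\<And>c x. c > 0 \<Longrightarrow> c *\<^sub>R x \<in> C \<longleftrightarrow> x \<in> C"
  shows "emeasure std_gaussian C = emeasure (uniform_measure lborel (ball 0 1)) C"
proof -
  define \<kappa> where "\<kappa> = (1 / sqrt (2 * pi)) ^ DIM('a)"
  define g where "g r = ennreal (r * exp (- (r\<^sup>2 / 2)))" for r
  \<comment> \<open>The factor between Gaussian mass of a cone and the volume of its part in the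
    unit ball. Its value is never computed: the case \<open>D = UNIV\<close> of the claim below
    shows that it is the reciprocal of the volume of the ball.\<close>
  define K where "K = ennreal \<kappa> * (\<integral>\<^sup>+r. g r * indicator {0<..} r * ennreal (r ^ DIM('a)) \<partial>lborel)"
  have [measurable]: "g \<in> borel_measurable borel" unfolding g_def by measurable
  have \<kappa>: "\<kappa> \<ge> 0" by (simp add: \<kappa>_def)
  have main: "emeasure std_gaussian D = K * emeasure lborel (D \<inter> ball 0 1)"
    if D [measurable]: "D \<in> sets borel" and cone: "\<And>c x. c > 0 \<Longrightarrow> c *\<^sub>R x \<in> D \<longleftrightarrow> x \<in> D" for D :: "'a set"
  proof -
    have "emeasure std_gaussian D = (\<integral>\<^sup>+x. ennreal (\<kappa> * exp (- ((norm x)\<^sup>2 / 2))) * indicator D x \<partial>lborel)"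
      unfolding std_gaussian_def by (subst emeasure_density) (simp_all add: std_gaussian_density \<kappa>_def)
    also have "\<dots> = (\<integral>\<^sup>+x. ennreal \<kappa> * (\<integral>\<^sup>+r. g r * indicator {norm x<..} r * indicator D x \<partial>lborel) \<partial>lborel)"
      unfolding g_def using \<kappa>
      by (intro nn_integral_cong, subst nn_integral_multc)
        (auto simp: nn_integral_gaussian_tail ennreal_mult mult.assoc)
    also have "\<dots> = ennreal \<kappa> * (\<integral>\<^sup>+x. (\<integral>\<^sup>+r. g r * indicator {norm x<..} r * indicator D x \<partial>lborel) \<partial>lborel)"
      by (rule nn_integral_cmult) (simp add: indicator_def)
    also have "(\<integral>\<^sup>+x. (\<integral>\<^sup>+r. g r * indicator {norm x<..} r * indicator D x \<partial>lborel) \<partial>lborel) =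
        (\<integral>\<^sup>+r. (\<integral>\<^sup>+x. g r * indicator {norm x<..} r * indicator D x \<partial>lborel) \<partial>lborel)"
      by (rule lborel_pair.Fubini') (simp add: indicator_def split_def)
    also have "\<dots> = (\<integral>\<^sup>+r. (g r * indicator {0<..} r * ennreal (r ^ DIM('a))) * emeasure lborel (D \<inter> ball 0 1) \<partial>lborel)"
    proof (rule nn_integral_cong)
      fix r :: real
      have "(\<integral>\<^sup>+x. g r * indicator {norm x<..} r * indicator D x \<partial>lborel) =
          (\<integral>\<^sup>+x. g r * indicator (D \<inter> ball 0 r) x \<partial>lborel)"
        by (intro nn_integral_cong) (auto simp: indicator_def)
      also have "\<dots> = g r * emeasure lborel (D \<inter> ball 0 r)"
        by (rule nn_integral_cmult_indicator) simp
      also have "\<dots> = (g r * indicator {0<..} r * ennreal (r ^ DIM('a))) * emeasure lborel (D \<inter> ball 0 1)"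
      proof (cases "r > 0")
        case True
        then show ?thesis using emeasure_cone_ball[OF D cone True] by (simp add: mult.assoc)
      next
        case False
        then show ?thesis by (simp add: ball_empty)
      qed
      finally show "(\<integral>\<^sup>+x. g r * indicator {norm x<..} r * indicator D x \<partial>lborel) =
          (g r * indicator {0<..} r * ennreal (r ^ DIM('a))) * emeasure lborel (D \<inter> ball 0 1)" .
    qed
    also have "\<dots> = (\<integral>\<^sup>+r. g r * indicator {0<..} r * ennreal (r ^ DIM('a)) \<partial>lborel) * emeasure lborel (D \<inter> ball 0 1)"
      by (rule nn_integral_multc) measurable
    finally show ?thesis by (simp add: K_def mult.assoc)
  qed
  interpret prob_space "std_gaussian :: 'a measure" by (rule prob_space_std_gaussian)
  define V where "V = emeasure lborel (ball (0::'a) 1)"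
  have V: "V \<noteq> \<top>" unfolding V_def using emeasure_lborel_ball_finite[of "0::'a" 1] by simp
  have KV: "K * V = 1" using main[of UNIV] emeasure_space_1 by (simp add: V_def)
  have "emeasure std_gaussian C = K * emeasure lborel (C \<inter> ball 0 1)" using C cone by (rule main)
  also have "\<dots> = emeasure lborel (C \<inter> ball 0 1) / V"
  proof -
    have "V \<noteq> 0" using KV by auto
    then have "K = 1 / V" using KV V by (metis ennreal_mult_divide_eq mult.commute)
    then show ?thesis by (simp add: divide_ennreal_def mult.commute)
  qed
  also have "\<dots> = emeasure (uniform_measure lborel (ball 0 1)) C"
    by (simp add: emeasure_uniform_measure V_def Int_commute)
  finally show ?thesis .
qed

text \<open>A cone is its own preimage under \<open>sgn\<close>, also at the origin because
  \<open>sgn 0 = 0\<close>; hence its spherical measure is its share of the unit ball, which is its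
  Gaussian measure.\<close>

lemma unit_sphere_measure_cone:
  fixes C :: "(real^'n) set"
  assumes C [measurable]: "C \<in> sets borel" and cone: "\<And>c x. c > 0 \<Longrightarrow> c *\<^sub>R x \<in> C \<longleftrightarrow> x \<in> C"
  shows "measure unit_sphere_measure C = measure std_gaussian C"
proof -
  have "sgn x \<in> C \<longleftrightarrow> x \<in> C" for x
    by (cases "x = 0") (auto simp: sgn_div_norm cone)
  then have "sgn -` C = C" by auto
  moreover have "(sgn :: real^'n \<Rightarrow> real^'n) \<in> uniform_measure lborel (ball 0 1) \<rightarrow>\<^sub>M borel"
    using borel_measurable_sgn_vec by (simp add: measurable_def)
  ultimately show ?thesis
    using emeasure_std_gaussian_cone[OF C cone]
    by (simp add: unit_sphere_measure_def emeasure_distr measure_def)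
qed

section \<open>Quadratic forms on the unit sphere\<close>

text \<open>Diagonalisation yields eigenvalues in some order, and the characteristic polynomial
  determines them up to a permutation of the indices. Permuting the columns accordingly realises the
  prescribed family.\<close>

lemma eigenvalue_family_orthonormal_columns:
  fixes A :: "real^'n^'n"
  assumes A: "transpose A = A" and \<mu>: "eigenvalue_family A \<mu>"
  obtains P where "orthogonal_matrix P" "\<And>l. A *v column l P = \<mu> l *\<^sub>R column l P"
proof -
  obtain Q \<nu> where Q: "orthogonal_matrix Q" "\<And>l. A *v column l Q = \<nu> l *\<^sub>R column l Q"
    using symmetric_matrix_diagonalisable[OF A] by blast
  have "image_mset \<mu> (mset_set UNIV) = image_mset \<nu> (mset_set UNIV)"
    using \<mu> det_mat_diff_of_eigenbasis[OF Q] unfolding eigenvalue_family_def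
    by (intro image_mset_eq_of_prod_eq) simp
  from image_mset_eq_implies_permutes[OF _ this]
  obtain p where p: "p permutes UNIV" "\<And>l. \<mu> l = \<nu> (p l)" by auto
  define P where "P = (\<chi> i l. Q $ i $ p l)"
  have col: "column l P = column (p l) Q" for l by (simp add: P_def column_def)
  have "orthogonal_matrix P"
    using Q(1) by (simp add: orthogonal_matrix_orthonormal_columns col inj_eq[OF permutes_inj[OF p(1)]])
  moreover have "A *v column l P = \<mu> l *\<^sub>R column l P" for l
    using Q(2) by (simp add: col p(2))
  ultimately show ?thesis by (rule that)
qed

text \<open>In the coordinates given by the eigenvectors \<open>A\<close> acts diagonally, and
  orthogonality removes \<open>P\<close> from the inner product.\<close>

lemma principal_axes:
  fixes A :: "real^'n^'n"
  assumes A: "transpose A = A" and \<mu>: "eigenvalue_family A \<mu>"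
  obtains T where "orthogonal_transformation T" "\<And>y. T y \<bullet> (A *v T y) = (\<Sum>l\<in>UNIV. \<mu> l * (y $ l)\<^sup>2)"
proof -
  obtain P where P: "orthogonal_matrix P" "\<And>l. A *v column l P = \<mu> l *\<^sub>R column l P"
    using eigenvalue_family_orthonormal_columns[OF A \<mu>] by blast
  have T: "orthogonal_transformation (\<lambda>y. P *v y)"
    using P(1) by (simp add: orthogonal_transformation_matrix)
  have "(P *v y) \<bullet> (A *v (P *v y)) = (\<Sum>l\<in>UNIV. \<mu> l * (y $ l)\<^sup>2)" for y
  proof -
    have "A *v (P *v y) = (\<Sum>l\<in>UNIV. (y $ l * \<mu> l) *\<^sub>R column l P)"
      by (simp add: matrix_mult_sum[of P] linear_sum[OF matrix_vector_mul_linear]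
          scalar_mult_eq_scaleR matrix_vector_mult_scaleR P(2))
    also have "\<dots> = P *v (\<chi> l. \<mu> l * y $ l)"
      by (simp add: matrix_mult_sum[of P] scalar_mult_eq_scaleR mult.commute)
    finally have "(P *v y) \<bullet> (A *v (P *v y)) = y \<bullet> (\<chi> l. \<mu> l * y $ l)"
      using T by (simp add: orthogonal_transformation_def)
    then show ?thesis by (simp add: inner_vec_def power2_eq_square mult_ac)
  qed
  with T that show ?thesis by blast
qed

lemma Basis_vec_eq_range_axis: "(Basis :: (real^'n) set) = range (\<lambda>l. axis l 1)"
  by (auto simp: Basis_vec_def)

text \<open>Rotation invariance of the spherical measure replaces the form of \<open>A\<close> by
  the diagonal form \<open>Q\<close>. The sign sets of \<open>Q\<close> are cones, so the Gaussian
  probabilities carry over.\<close>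

lemma
  fixes A :: "real^'n^'n"
  assumes A: "transpose A = A" and \<mu>: "eigenvalue_family A \<mu>" and nz: "\<mu> k \<noteq> 0"
  defines "J \<equiv> LBINT u:{0<..}. sin (1 / 2 * (\<Sum>l\<in>UNIV. arctan (\<mu> l * u))) /
      (u * (\<Prod>l\<in>UNIV. (1 + (\<mu> l)\<^sup>2 * u\<^sup>2) powr (1 / 4)))"
  shows unit_sphere_quadratic_form_pos:
      "measure unit_sphere_measure {x. x \<bullet> (A *v x) > 0} = 1 / 2 + 1 / pi * J"
    and unit_sphere_quadratic_form_neg:
      "measure unit_sphere_measure {x. x \<bullet> (A *v x) < 0} = 1 / 2 - 1 / pi * J"
proof -
  \<comment> \<open>The Gaussian results index coefficients by basis vectors, the eigenvalues are
    indexed by coordinates; \<open>a\<close> translates between the two.\<close>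
  define a where "a = \<mu> \<circ> inv (\<lambda>l. axis l (1::real))"
  have inj: "inj (\<lambda>l :: 'n. axis l (1::real))" by (auto simp: inj_def axis_eq_axis)
  have a: "a (axis l 1) = \<mu> l" for l by (simp add: a_def inv_f_f[OF inj])
  have sum_Basis: "(\<Sum>b\<in>Basis. h b) = (\<Sum>l\<in>UNIV. h (axis l 1))" for h :: "real^'n \<Rightarrow> real"
    unfolding Basis_vec_eq_range_axis by (simp add: sum.reindex[OF inj])
  have prod_Basis: "(\<Prod>b\<in>Basis. h b) = (\<Prod>l\<in>UNIV. h (axis l 1))" for h :: "real^'n \<Rightarrow> real"
    unfolding Basis_vec_eq_range_axis by (simp add: prod.reindex[OF inj])
  have k: "axis k 1 \<in> (Basis :: (real^'n) set)" "a (axis k 1) \<noteq> 0"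
    using nz by (auto simp: a Basis_vec_eq_range_axis)
  define Q where "Q y = (\<Sum>l\<in>UNIV. \<mu> l * (y $ l)\<^sup>2)" for y :: "real^'n"
  have Q: "(\<Sum>b\<in>Basis. a b * (y \<bullet> b)\<^sup>2) = Q y" for y
    by (simp add: sum_Basis a Q_def inner_axis)
  have gauss: "measure std_gaussian {y. Q y > 0} = 1 / 2 + 1 / pi * J"
    "measure std_gaussian {y. Q y < 0} = 1 / 2 - 1 / pi * J"
    using std_gaussian_quadratic_pos[of "axis k 1" a] std_gaussian_quadratic_neg[of "axis k 1" a] k
    unfolding Q by (simp_all add: sum_Basis prod_Basis a J_def)
  have [measurable]: "Q \<in> borel_measurable borel" unfolding Q_def by measurable
  obtain T where T: "orthogonal_transformation T" "\<And>y. T y \<bullet> (A *v T y) = Q y"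
    using principal_axes[OF A \<mu>] unfolding Q_def by blast
  have [measurable]: "T \<in> borel_measurable borel"
    using orthogonal_transformation_linear[OF T(1)]
    by (intro borel_measurable_continuous_onI linear_continuous_on) (simp add: linear_conv_bounded_linear)
  have qA [measurable]: "(\<lambda>x. x \<bullet> (A *v x)) \<in> borel_measurable borel"
    by (intro borel_measurable_continuous_onI continuous_intros)
  have rotate: "measure unit_sphere_measure {x. R (x \<bullet> (A *v x))} = measure unit_sphere_measure {y. R (Q y)}"
    if [measurable]: "Measurable.pred borel R" for R
  proof -
    have "measure unit_sphere_measure {x. R (x \<bullet> (A *v x))} =
        measure (distr unit_sphere_measure borel T) {x. R (x \<bullet> (A *v x))}"
      by (simp only: unit_sphere_measure_rotation_invariant[OF T(1)])
    also have "\<dots> = measure unit_sphere_measure (T -` {x. R (x \<bullet> (A *v x))} \<inter> space unit_sphere_measure)"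
      by (rule measure_distr) (auto simp: unit_sphere_measure_def)
    also have "T -` {x. R (x \<bullet> (A *v x))} \<inter> space unit_sphere_measure = {y. R (Q y)}"
      by (auto simp: T(2) unit_sphere_measure_def)
    finally show ?thesis .
  qed
  have scale: "Q (c *\<^sub>R y) = c\<^sup>2 * Q y" for c y
    by (simp add: Q_def sum_distrib_left power_mult_distrib mult_ac)
  have "measure unit_sphere_measure {x. x \<bullet> (A *v x) > 0} = measure unit_sphere_measure {y. Q y > 0}"
    by (rule rotate) simp
  also have "\<dots> = measure std_gaussian {y. Q y > 0}"
    by (rule unit_sphere_measure_cone) (auto simp: scale zero_less_mult_iff)
  finally show "measure unit_sphere_measure {x. x \<bullet> (A *v x) > 0} = 1 / 2 + 1 / pi * J"
    using gauss by simp
  have "measure unit_sphere_measure {x. x \<bullet> (A *v x) < 0} = measure unit_sphere_measure {y. Q y < 0}"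
    by (rule rotate) simp
  also have "\<dots> = measure std_gaussian {y. Q y < 0}"
    by (rule unit_sphere_measure_cone) (auto simp: scale mult_less_0_iff)
  finally show "measure unit_sphere_measure {x. x \<bullet> (A *v x) < 0} = 1 / 2 - 1 / pi * J"
    using gauss by simp
qed

lemma eigenvalue_family_diff_mat:
  assumes "eigenvalue_family A \<mu>"
  shows "eigenvalue_family (A - mat c) (\<lambda>l. \<mu> l - c)"
proof -
  have "mat x - (A - mat c) = mat (x + c) - A" for x
    by (simp add: vec_eq_iff mat_def)
  then show ?thesis
    using assms by (simp add: eigenvalue_family_def algebra_simps)
qed

text \<open>The halves from the positive and the negative event add up to the leading 1. The term
  \<open>J (- \<epsilon>)\<close> belongs to the negative event, hence its minus sign and the
  eigenvalues raised by \<open>\<epsilon>\<close>. The conditions on \<open>k\<close> and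
  \<open>l\<close> keep both shifted matrices from vanishing.\<close>

lemma uniform_on_unit_sphere_rayleigh_quotient:
  fixes A :: "real^'n^'n" and X :: "'a \<Rightarrow> real^'n"
  assumes X: "uniform_on_unit_sphere M X" and A: "transpose A = A" and \<mu>: "eigenvalue_family A \<mu>"
    and \<epsilon>: "\<epsilon> > 0" and nz: "\<mu> k \<noteq> \<epsilon>" "\<mu> l \<noteq> - \<epsilon>"
  defines "J \<equiv> \<lambda>c. LBINT u:{0<..}. sin (1 / 2 * (\<Sum>l\<in>UNIV. arctan ((\<mu> l - c) * u))) /
      (u * (\<Prod>l\<in>UNIV. (1 + (\<mu> l - c)\<^sup>2 * u\<^sup>2) powr (1 / 4)))"
  shows "\<P>(\<omega> in M. \<bar>X \<omega> \<bullet> (A *v X \<omega>)\<bar> / (norm (X \<omega>))\<^sup>2 > \<epsilon>) = 1 + 1 / pi * J \<epsilon> - 1 / pi * J (- \<epsilon>)"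
proof -
  interpret U: prob_space "unit_sphere_measure :: (real^'n) measure" by (rule prob_space_unit_sphere_measure)
  have sets_U [simp]: "sets (unit_sphere_measure :: (real^'n) measure) = sets borel"
    by (simp add: unit_sphere_measure_def)
  have qm [measurable]: "(\<lambda>x. x \<bullet> (D *v x)) \<in> borel_measurable borel" for D :: "real^'n^'n"
    by (intro borel_measurable_continuous_onI continuous_intros)
  have XM [measurable]: "X \<in> borel_measurable M" and dX: "distr M borel X = unit_sphere_measure"
    using X by (auto simp: uniform_on_unit_sphere_def)
  let ?P = "{x. x \<bullet> ((A - mat \<epsilon>) *v x) > 0}" and ?N = "{x. x \<bullet> ((A - mat (- \<epsilon>)) *v x) < 0}"
  have q: "x \<bullet> ((A - mat c) *v x) = x \<bullet> (A *v x) - c * (norm x)\<^sup>2" for x and c :: real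
  proof -
    have "mat c *v x = c *\<^sub>R x"
      by (simp add: vec_eq_iff mat_def matrix_vector_mult_def if_distrib[of "\<lambda>z. z * _"] cong: if_cong)
    then show ?thesis
      by (simp add: matrix_vector_mult_diff_rdistrib inner_diff_right dot_square_norm)
  qed
  \<comment> \<open>At \<open>x = 0\<close> the quotient is 0 by the convention for division by
    zero, so the origin lies in neither side.\<close>
  have "{x. \<bar>x \<bullet> (A *v x)\<bar> / (norm x)\<^sup>2 > \<epsilon>} = ?P \<union> ?N"
  proof (rule set_eqI)
    fix x
    show "x \<in> {x. \<bar>x \<bullet> (A *v x)\<bar> / (norm x)\<^sup>2 > \<epsilon>} \<longleftrightarrow> x \<in> ?P \<union> ?N"
      using \<epsilon> by (cases "x = 0") (auto simp: q less_divide_eq abs_if)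
  qed
  moreover have "?P \<inter> ?N = {}"
  proof -
    have "0 \<le> \<epsilon> * (norm x)\<^sup>2" for x :: "real^'n" using \<epsilon> by simp
    then show ?thesis by (auto simp: q) (smt (verit))
  qed
  moreover have transpose: "transpose (A - mat c) = A - mat c" for c
    using A by (auto simp: transpose_def mat_def vec_eq_iff)
  ultimately have "measure unit_sphere_measure {x. \<bar>x \<bullet> (A *v x)\<bar> / (norm x)\<^sup>2 > \<epsilon>} =
      measure unit_sphere_measure ?P + measure unit_sphere_measure ?N"
    by (simp add: U.finite_measure_Union)
  also have "measure unit_sphere_measure ?P = 1 / 2 + 1 / pi * J \<epsilon>"
    unfolding J_def
    by (rule unit_sphere_quadratic_form_pos[OF transpose eigenvalue_family_diff_mat[OF \<mu>], where k=k])
      (use nz in simp)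
  also have "measure unit_sphere_measure ?N = 1 / 2 - 1 / pi * J (- \<epsilon>)"
    unfolding J_def
    by (rule unit_sphere_quadratic_form_neg[OF transpose eigenvalue_family_diff_mat[OF \<mu>], where k=l])
      (use nz in simp)
  also have "measure unit_sphere_measure {x. \<bar>x \<bullet> (A *v x)\<bar> / (norm x)\<^sup>2 > \<epsilon>} =
      \<P>(\<omega> in M. \<bar>X \<omega> \<bullet> (A *v X \<omega>)\<bar> / (norm (X \<omega>))\<^sup>2 > \<epsilon>)"
    unfolding dX[symmetric] by (subst measure_distr) (auto intro!: arg_cong[of _ _ "measure M"])
  finally show ?thesis by simp
qed

text \<open>The proof applies the result for a fixed symmetric matrix to each \<open>j\<close>. The
  premise on the eigenvalues excludes the matrices \<open>\<epsilon> I\<close> and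
  \<open>- \<epsilon> I\<close>: for them the quotient is exactly \<open>\<epsilon>\<close> on the
  sphere and the probability is 0, while the right-hand side equals 1/2. Integrability is asserted
  separately because a non-integrable function would have integral 0 by convention.\<close>

theorem theorem6p2:
  fixes F :: "real^'n \<Rightarrow> real"
    and w :: "real^'n"
    and m :: nat
    and \<epsilon> \<gamma> :: real
    and s y :: "nat \<Rightarrow> real^'n"
    and B :: "nat \<Rightarrow> real^'n^'n"
    and \<mu> :: "nat \<Rightarrow> 'n \<Rightarrow> real"
    and M :: "'a measure"
    and S :: "nat \<Rightarrow> 'a \<Rightarrow> real^'n"
  assumes "twice_continuously_differentiable F"
    and "m \<ge> 1"
    and "\<epsilon> > 0"
    and "\<forall>i\<in>{1..<m}. y i = hessian F w *v s i"
    and "\<forall>j\<in>{1..m}. B (j - 1) = sr1_matrix \<epsilon> (mat \<gamma>) s y (j - 1)"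
    and "\<forall>j\<in>{1..m}. eigenvalue_family (hessian F w - B (j - 1)) (\<mu> (j - 1))"
    and "prob_space M"
    and "\<forall>j\<in>{1..m}. uniform_on_unit_sphere M (S j)"
  shows "\<forall>j\<in>{1..m}. (\<exists>l. \<mu> (j - 1) l \<noteq> \<epsilon>) \<and> (\<exists>l. \<mu> (j - 1) l \<noteq> - \<epsilon>) \<longrightarrow>
    (let f = (\<lambda>u. sin (1 / 2 * (\<Sum>l\<in>UNIV. arctan ((\<mu> (j - 1) l - \<epsilon>) * u))) /
                  (u * (\<Prod>l\<in>UNIV. (1 + (\<mu> (j - 1) l - \<epsilon>)\<^sup>2 * u\<^sup>2) powr (1 / 4))));
         g = (\<lambda>u. sin (1 / 2 * (\<Sum>l\<in>UNIV. arctan ((\<mu> (j - 1) l + \<epsilon>) * u))) /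
                  (u * (\<Prod>l\<in>UNIV. (1 + (\<mu> (j - 1) l + \<epsilon>)\<^sup>2 * u\<^sup>2) powr (1 / 4))))
     in set_integrable lborel {0<..} f \<and> set_integrable lborel {0<..} g \<and>
        \<P>(\<omega> in M. \<bar>S j \<omega> \<bullet> ((hessian F w - B (j - 1)) *v S j \<omega>)\<bar> / (norm (S j \<omega>))\<^sup>2 > \<epsilon>) =
          1 + 1 / pi * (LINT u:{0<..}|lborel. f u) - 1 / pi * (LINT u:{0<..}|lborel. g u))"
proof (intro ballI impI)
  fix j assume j: "j \<in> {1..m}" and "(\<exists>l. \<mu> (j - 1) l \<noteq> \<epsilon>) \<and> (\<exists>l. \<mu> (j - 1) l \<noteq> - \<epsilon>)"
  \<comment> \<open>These indices give a nonzero eigenvalue of each shifted matrix, as the decay of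
    the two integrands requires.\<close>
  then obtain k l where kl: "\<mu> (j - 1) k \<noteq> \<epsilon>" "\<mu> (j - 1) l \<noteq> - \<epsilon>" by auto
  have "transpose (hessian F w - B (j - 1)) = transpose (hessian F w) - transpose (B (j - 1))"
    by (simp add: transpose_def vec_eq_iff)
  also have "\<dots> = hessian F w - B (j - 1)"
    using assms(1,5) j by (simp add: transpose_hessian transpose_sr1_matrix transpose_mat)
  finally have sym: "transpose (hessian F w - B (j - 1)) = hessian F w - B (j - 1)" .
  have "uniform_on_unit_sphere M (S j)" "eigenvalue_family (hessian F w - B (j - 1)) (\<mu> (j - 1))"
    using assms(6,8) j by auto
  from uniform_on_unit_sphere_rayleigh_quotient[OF this(1) sym this(2) \<open>\<epsilon> > 0\<close> kl]
    set_integrable_imhof[of UNIV k "\<lambda>l. \<mu> (j - 1) l - \<epsilon>"]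
    set_integrable_imhof[of UNIV l "\<lambda>l. \<mu> (j - 1) l + \<epsilon>"] kl
  show "let f = (\<lambda>u. sin (1 / 2 * (\<Sum>l\<in>UNIV. arctan ((\<mu> (j - 1) l - \<epsilon>) * u))) /
                  (u * (\<Prod>l\<in>UNIV. (1 + (\<mu> (j - 1) l - \<epsilon>)\<^sup>2 * u\<^sup>2) powr (1 / 4))));
         g = (\<lambda>u. sin (1 / 2 * (\<Sum>l\<in>UNIV. arctan ((\<mu> (j - 1) l + \<epsilon>) * u))) /
                  (u * (\<Prod>l\<in>UNIV. (1 + (\<mu> (j - 1) l + \<epsilon>)\<^sup>2 * u\<^sup>2) powr (1 / 4))))
     in set_integrable lborel {0<..} f \<and> set_integrable lborel {0<..} g \<and>
        \<P>(\<omega> in M. \<bar>S j \<omega> \<bullet> ((hessian F w - B (j - 1)) *v S j \<omega>)\<bar> / (norm (S j \<omega>))\<^sup>2 > \<epsilon>) =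
          1 + 1 / pi * (LINT u:{0<..}|lborel. f u) - 1 / pi * (LINT u:{0<..}|lborel. g u)"
    unfolding Let_def diff_minus_eq_add by (auto simp: add_eq_0_iff2)
qed

end
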